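(* Let $\mathcal{H}$ be a complex Hilbert space, let $\Omega$ be a symmetric sesquilinear form defined on a dense subspace $\mathcal{D}$ of $\mathcal{H}$, and let $\lambda\in\mathbb{R}$. Then $\Omega$ is closed with gap point $\lambda$ (in the sense of Fleige, Hassi and de Snoo) if and only if $\Omega$ is solvable with respect to (the norm induced by) an inner product on $\mathcal{D}$ and $-\lambda\iota\in\mathfrak{P}(\Omega)$.
   Context: Let $\langle\cdot|\cdot\rangle$ and $\|\cdot\|$ be the inner product and norm of $\mathcal{H}$; $\iota(\xi,\eta)=\langle\xi|\eta\rangle$. Sesquilinear forms are linear in the first variable and conjugate linear in the second; a form $\Omega$ is symmetric if $\Omega(\xi,\eta)=\overline{\Omega(\eta,\xi)}$ for all $\xi,\eta$ in its domain. Krein space: a pair $(\mathcal{D},[\cdot,\cdot])$ with $[\cdot,\cdot]$ a symmetric sesquilinear form on $\mathcal{D}$ admitting a decomposition $\mathcal{D}=\mathcal{D}_+\dotplus\mathcal{D}_-$, orthogonal with respect to $[\cdot,\cdot]$, such that $(\mathcal{D}_+,[\cdot,\cdot])$ and $(\mathcal{D}_-,-[\cdot,\cdot])$ are Hilbert spaces. Its topology is that of the Hilbert space $\mathcal{D}_+\oplus\mathcal{D}_-$ so obtained (independent of the decomposition). A symmetric form $\Omega$ on the dense subspace $\mathcal{D}$ is closed with gap point $\lambda$ (in the sense of Fleige, Hassi and de Snoo) if $(\mathcal{D},\Omega-\lambda\iota)$ is a Krein space which is continuously embedded in $\mathcal{H}$, i.e. the inclusion $\mathcal{D}\hookrightarrow\mathcal{H}$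 is continuous for the Krein space topology. A sesquilinear form $\Omega$ on the dense subspace $\mathcal{D}$ is q-closed with respect to a norm $\|\cdot\|_\Omega$ on $\mathcal{D}$ if: (1) there is $\alpha>0$ with $\|\xi\|\le\alpha\|\xi\|_\Omega$ for all $\xi\in\mathcal{D}$; (2) if $\{\xi_n\}\subset\mathcal{D}$, $\|\xi_n\|\to0$ and $\|\xi_n-\xi_m\|_\Omega\to0$, then $\|\xi_n\|_\Omega\to0$; (3) $\mathcal{E}_\Omega:=\mathcal{D}[\|\cdot\|_\Omega]$ is a reflexive Banach space; (4) there is $\beta>0$ with $|\Omega(\xi,\eta)|\le\beta\|\xi\|_\Omega\|\eta\|_\Omega$ for all $\xi,\eta\in\mathcal{D}$. Let $\mathcal{E}_\Omega^\times$ be the conjugate dual of $\mathcal{E}_\Omega$ (bounded conjugate linear functionals). $\mathfrak{P}(\Omega)$ is the set of bounded sesquilinear forms $\Upsilon$ on $\mathcal{H}$ such that (i) if $\xi\in\mathcal{D}$ and $(\Omega+\Upsilon)(\xi,\eta)=0$ for all $\eta\in\mathcal{D}$, then $\xi=0$; (ii) for every $\Lambda\in\mathcal{E}_\Omega^\times$ there is $\xi\in\mathcal{D}$ with $\Lambda(\eta)=(\Omega+\Upsilon)(\xi,\eta)$ for all $\eta\in\mathcal{D}$. $\Omega$ is solvable with respect to $\|\cdot\|_\Omega$ if it is q-closed with respect to $\|\cdot\|_\Omega$ and $\mathfrak{P}(\Omega)\neq\varnothing$; it is solvable with respect to an inner product if it is solvable with respect to the norm induced by that inner product. *)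

theory Defs
  imports "HOL-Analysis.Analysis" "HOL-Library.Function_Algebras"
begin

subsection \<open>Complex vector spaces and complex Hilbert spaces\<close>

class complex_vec = ab_group_add +
  fixes scaleC :: "complex \<Rightarrow> 'a \<Rightarrow> 'a"  (infixr \<open>*\<^sub>C\<close> 75)
  assumes scaleC_add_right: "a *\<^sub>C (x + y) = a *\<^sub>C x + a *\<^sub>C y"
    and scaleC_add_left: "(a + b) *\<^sub>C x = a *\<^sub>C x + b *\<^sub>C x"
    and scaleC_scaleC: "a *\<^sub>C b *\<^sub>C x = (a * b) *\<^sub>C x"
    and scaleC_one: "1 *\<^sub>C x = x"

global_interpretation complex_vector:
  vector_space "scaleC :: complex \<Rightarrow> 'a \<Rightarrow> 'a::complex_vec"
  by unfold_locales (rule scaleC_add_right scaleC_add_left scaleC_scaleC scaleC_one)+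

text \<open>Completeness is inherited from \<^class>\<open>banach\<close>, whose norm is required to be the one
  induced by the inner product.\<close>

class complex_hilbert = complex_vec + banach +
  fixes cinner :: "'a \<Rightarrow> 'a \<Rightarrow> complex"
  assumes scaleR_scaleC: "scaleR r x = complex_of_real r *\<^sub>C x"
    and cinner_add_left: "cinner (x + y) z = cinner x z + cinner y z"
    and cinner_scaleC_left: "cinner (a *\<^sub>C x) y = a * cinner x y"
    and cinner_commute: "cinner x y = cnj (cinner y x)"
    and cinner_ge_zero: "0 \<le> Re (cinner x x)"
    and cinner_eq_zero_iff: "cinner x x = 0 \<longleftrightarrow> x = 0"
    and norm_eq_sqrt_cinner: "norm x = sqrt (Re (cinner x x))"

instantiation complex :: complex_hilbert
begin
definition scaleC_complex :: "complex \<Rightarrow> complex \<Rightarrow> complex"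
  where "scaleC_complex a x = a * x"
definition cinner_complex :: "complex \<Rightarrow> complex \<Rightarrow> complex"
  where "cinner_complex x y = x * cnj y"
instance
  by intro_classes
    (auto simp: scaleC_complex_def cinner_complex_def algebra_simps scaleR_conv_of_real
      cmod_def power2_eq_square)
end

instantiation "fun" :: (type, complex_vec) complex_vec
begin
definition scaleC_fun :: "complex \<Rightarrow> ('a \<Rightarrow> 'b) \<Rightarrow> 'a \<Rightarrow> 'b"
  where "scaleC_fun a f = (\<lambda>x. a *\<^sub>C f x)"
instance
  by intro_classes
    (auto simp: scaleC_fun_def fun_eq_iff scaleC_add_right scaleC_add_left scaleC_scaleC scaleC_one)
end

subsection \<open>Sesquilinear forms on a subspace\<close>

text \<open>A form on \<open>V\<close> is a total function of which only the values on \<open>V \<times> V\<close> matter.\<close>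

definition sesquilinear_on :: "'a::complex_vec set \<Rightarrow> ('a \<Rightarrow> 'a \<Rightarrow> complex) \<Rightarrow> bool" where
  "sesquilinear_on V f \<longleftrightarrow>
     (\<forall>x\<in>V. \<forall>y\<in>V. \<forall>z\<in>V. f (x + y) z = f x z + f y z \<and> f z (x + y) = f z x + f z y) \<and>
     (\<forall>a. \<forall>x\<in>V. \<forall>y\<in>V. f (a *\<^sub>C x) y = a * f x y \<and> f x (a *\<^sub>C y) = cnj a * f x y)"

definition symmetric_on :: "'a set \<Rightarrow> ('a \<Rightarrow> 'a \<Rightarrow> complex) \<Rightarrow> bool" where
  "symmetric_on V f \<longleftrightarrow> (\<forall>x\<in>V. \<forall>y\<in>V. f x y = cnj (f y x))"

definition inner_product_on :: "'a::complex_vec set \<Rightarrow> ('a \<Rightarrow> 'a \<Rightarrow> complex) \<Rightarrow> bool" where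
  "inner_product_on V f \<longleftrightarrow>
     sesquilinear_on V f \<and> symmetric_on V f \<and> (\<forall>x\<in>V. x \<noteq> 0 \<longrightarrow> 0 < Re (f x x))"

definition form_norm :: "('a \<Rightarrow> 'a \<Rightarrow> complex) \<Rightarrow> 'a \<Rightarrow> real" where
  "form_norm f x = sqrt (Re (f x x))"

text \<open>\<^locale>\<open>Metric_space\<close> requires nonnegativity and symmetry of the distance also outside the
  carrier, where \<open>n\<close> is arbitrary; hence the default value \<open>0\<close> there.\<close>

definition norm_dist :: "'a::ab_group_add set \<Rightarrow> ('a \<Rightarrow> real) \<Rightarrow> 'a \<Rightarrow> 'a \<Rightarrow> real" where
  "norm_dist V n x y = (if x \<in> V \<and> y \<in> V then n (x - y) else 0)"

definition norm_on :: "'a::complex_vec set \<Rightarrow> ('a \<Rightarrow> real) \<Rightarrow> bool" where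
  "norm_on V n \<longleftrightarrow>
     (\<forall>x\<in>V. 0 \<le> n x \<and> (n x = 0 \<longleftrightarrow> x = 0)) \<and>
     (\<forall>x\<in>V. \<forall>y\<in>V. n (x + y) \<le> n x + n y) \<and>
     (\<forall>a. \<forall>x\<in>V. n (a *\<^sub>C x) = cmod a * n x)"

lemma Metric_space_norm_dist:
  assumes V: "complex_vector.subspace V" and n: "norm_on V n"
  shows "Metric_space V (norm_dist V n)"
proof
  fix x y z
  show "0 \<le> norm_dist V n x y"
    using V n by (simp add: norm_dist_def norm_on_def complex_vector.subspace_diff)
  show "norm_dist V n x y = norm_dist V n y x"
  proof -
    have "n (x - y) = n (y - x)" if "x \<in> V" "y \<in> V"
    proof -
      have "n ((-1) *\<^sub>C (x - y)) = cmod (-1) * n (x - y)"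
        using V n that by (simp only: norm_on_def complex_vector.subspace_diff)
      then show ?thesis by (simp add: complex_vector.scale_minus_left)
    qed
    then show ?thesis by (auto simp: norm_dist_def)
  qed
  show "norm_dist V n x y = 0 \<longleftrightarrow> x = y" if "x \<in> V" "y \<in> V"
    using V n that by (simp add: norm_dist_def norm_on_def complex_vector.subspace_diff)
  show "norm_dist V n x z \<le> norm_dist V n x y + norm_dist V n y z"
    if "x \<in> V" "y \<in> V" "z \<in> V"
  proof -
    have "n ((x - y) + (y - z)) \<le> n (x - y) + n (y - z)"
      using V n that by (simp only: norm_on_def complex_vector.subspace_diff)
    with that show ?thesis by (simp add: norm_dist_def)
  qed
qed

lemma norm_on_form_norm:
  assumes V: "complex_vector.subspace V" and g: "inner_product_on V g"
  shows "norm_on V (form_norm g)"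
proof -
  have add: "g (x + y) z = g x z + g y z" "g z (x + y) = g z x + g z y"
    if "x \<in> V" "y \<in> V" "z \<in> V" for x y z
    using g that by (auto simp: inner_product_on_def sesquilinear_on_def)
  have sc: "g (a *\<^sub>C x) y = a * g x y" "g x (a *\<^sub>C y) = cnj a * g x y"
    if "x \<in> V" "y \<in> V" for a x y
    using g that by (auto simp: inner_product_on_def sesquilinear_on_def)
  have comm: "g x y = cnj (g y x)" if "x \<in> V" "y \<in> V" for x y
    using g that unfolding inner_product_on_def symmetric_on_def by blast
  have V0: "0 \<in> V" and Vs: "a *\<^sub>C x \<in> V" if "x \<in> V" for a x
    using V that by (auto intro: complex_vector.subspace_0 complex_vector.subspace_scale)
  have g0: "g 0 x = 0" "g x 0 = 0" if "x \<in> V" for x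
    using sc[of x x 0] sc[of 0 x 0] sc[of x 0 0] V0[OF that] that by auto
  have pos: "0 < Re (g x x)" if "x \<in> V" "x \<noteq> 0" for x
    using g that by (auto simp: inner_product_on_def)
  have nn: "0 \<le> Re (g x x)" if "x \<in> V" for x
    using pos[OF that] g0[OF that] by (cases "x = 0") auto
  have exp: "Re (g (x + y) (x + y)) = Re (g x x) + 2 * Re (g x y) + Re (g y y)"
    if "x \<in> V" "y \<in> V" for x y
    using add that comm[of y x] complex_vector.subspace_add[OF V that] by simp
  have cs: "Re (g x y) \<le> sqrt (Re (g x x)) * sqrt (Re (g y y))" if x: "x \<in> V" and y: "y \<in> V" for x y
  proof (cases "y = 0")
    case True
    then show ?thesis using g0[OF x] g0[OF y] by simp
  next
    case False
    define c where "c = Re (g y y)"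
    define b where "b = Re (g x y)"
    have c: "0 < c" using pos y False by (simp add: c_def)
    define t where "t = - b / c"
    have "0 \<le> Re (g (x + of_real t *\<^sub>C y) (x + of_real t *\<^sub>C y))"
      using nn x y Vs V complex_vector.subspace_add by blast
    also have "\<dots> = Re (g x x) + 2 * (t * b) + t * (t * c)"
      using x y Vs[OF y] by (simp add: exp sc b_def c_def)
    also have "\<dots> = Re (g x x) - b\<^sup>2 / c"
      using c by (simp add: t_def power2_eq_square field_simps)
    finally have "b\<^sup>2 \<le> Re (g x x) * c"
      using c by (simp add: field_simps)
    then have "b \<le> sqrt (Re (g x x) * c)"
      by (rule real_le_rsqrt)
    then show ?thesis by (simp add: b_def c_def real_sqrt_mult)
  qed
  have tri: "form_norm g (x + y) \<le> form_norm g x + form_norm g y" if "x \<in> V" "y \<in> V" for x y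
  proof -
    have "Re (g (x + y) (x + y)) \<le> (form_norm g x + form_norm g y)\<^sup>2"
      using cs[OF that] nn[OF that(1)] nn[OF that(2)]
      by (simp add: exp[OF that] power2_sum form_norm_def)
    then show ?thesis
      unfolding form_norm_def using nn[OF that(1)] nn[OF that(2)]
      by (intro real_le_lsqrt add_nonneg_nonneg) auto
  qed
  have hom: "form_norm g (a *\<^sub>C x) = cmod a * form_norm g x" if "x \<in> V" for a x
  proof -
    have "g (a *\<^sub>C x) (a *\<^sub>C x) = of_real ((cmod a)\<^sup>2) * g x x"
      using that Vs[OF that] by (simp only: sc complex_norm_square mult_ac)
    then have "Re (g (a *\<^sub>C x) (a *\<^sub>C x)) = (cmod a)\<^sup>2 * Re (g x x)"
      by (simp only: Re_complex_of_real Im_complex_of_real times_complex.simps)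
    then show ?thesis
      by (simp only: form_norm_def real_sqrt_mult real_sqrt_abs abs_norm_cancel)
  qed
  show ?thesis
    unfolding norm_on_def
  proof (intro conjI ballI allI)
    fix x assume "x \<in> V"
    then show "0 \<le> form_norm g x" by (simp add: form_norm_def nn)
    show "form_norm g x = 0 \<longleftrightarrow> x = 0"
      using pos[OF \<open>x \<in> V\<close>] g0[OF \<open>x \<in> V\<close>] by (cases "x = 0") (auto simp: form_norm_def)
  qed (simp_all only: tri hom)
qed

definition hilbert_on :: "'a::complex_vec set \<Rightarrow> ('a \<Rightarrow> 'a \<Rightarrow> complex) \<Rightarrow> bool" where
  "hilbert_on V f \<longleftrightarrow>
     complex_vector.subspace V \<and> inner_product_on V f \<and>
     Metric_space.mcomplete V (norm_dist V (form_norm f))"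

subsection \<open>Krein spaces and closed forms with a gap point\<close>

definition fundamental_decomposition ::
    "'a::complex_vec set \<Rightarrow> ('a \<Rightarrow> 'a \<Rightarrow> complex) \<Rightarrow> 'a set \<Rightarrow> 'a set \<Rightarrow> bool" where
  "fundamental_decomposition D f Dp Dm \<longleftrightarrow>
     hilbert_on Dp f \<and> hilbert_on Dm (\<lambda>x y. - f x y) \<and>
     D = {x + y |x y. x \<in> Dp \<and> y \<in> Dm} \<and> Dp \<inter> Dm = {0} \<and>
     (\<forall>x\<in>Dp. \<forall>y\<in>Dm. f x y = 0)"

definition krein_space :: "'a::complex_vec set \<Rightarrow> ('a \<Rightarrow> 'a \<Rightarrow> complex) \<Rightarrow> bool" where
  "krein_space D f \<longleftrightarrow>
     complex_vector.subspace D \<and> sesquilinear_on D f \<and> symmetric_on D f \<and>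
     (\<exists>Dp Dm. fundamental_decomposition D f Dp Dm)"

text \<open>The inner product of the Hilbert space \<open>Dp \<oplus> Dm\<close>, transported to \<open>D\<close>: for \<open>x = p + m\<close> and
  \<open>y = q + k\<close> with \<open>p, q \<in> Dp\<close> and \<open>m, k \<in> Dm\<close> it is \<open>f p q - f m k\<close>. The components are unique
  because the sum is direct.\<close>

definition krein_inner ::
    "('a::complex_vec \<Rightarrow> 'a \<Rightarrow> complex) \<Rightarrow> 'a set \<Rightarrow> 'a set \<Rightarrow> 'a \<Rightarrow> 'a \<Rightarrow> complex" where
  "krein_inner f Dp Dm x y =
     (let P = (\<lambda>x. THE p. p \<in> Dp \<and> x - p \<in> Dm) in f (P x) (P y) - f (x - P x) (y - P y))"

lemma krein_inner_eq:
  assumes dec: "fundamental_decomposition D f Dp Dm"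
    and p: "p \<in> Dp" "q \<in> Dp" and m: "m \<in> Dm" "k \<in> Dm"
  shows "krein_inner f Dp Dm (p + m) (q + k) = f p q - f m k"
proof -
  have sub: "complex_vector.subspace Dp" "complex_vector.subspace Dm" and int: "Dp \<inter> Dm = {0}"
    using dec unfolding fundamental_decomposition_def hilbert_on_def by blast+
  have "(THE r. r \<in> Dp \<and> a + b - r \<in> Dm) = a" if a: "a \<in> Dp" and b: "b \<in> Dm" for a b
  proof (rule the_equality)
    show "a \<in> Dp \<and> a + b - a \<in> Dm" using a b by simp
    fix r assume r: "r \<in> Dp \<and> a + b - r \<in> Dm"
    have "r - a \<in> Dp" using r a sub complex_vector.subspace_diff by blast
    moreover have "b - (a + b - r) \<in> Dm" using r b sub complex_vector.subspace_diff by blast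
    then have "r - a \<in> Dm" by (simp add: algebra_simps)
    ultimately have "r - a = 0" using int by blast
    then show "r = a" by simp
  qed
  then show ?thesis using p m by (simp add: krein_inner_def)
qed

text \<open>The topology induced by \<^const>\<open>krein_inner\<close> does not depend on the fundamental decomposition,
  so quantifying the decomposition existentially or universally gives the same notion.\<close>

definition krein_topology ::
    "'a::complex_vec set \<Rightarrow> ('a \<Rightarrow> 'a \<Rightarrow> complex) \<Rightarrow> 'a set \<Rightarrow> 'a set \<Rightarrow> 'a topology" where
  "krein_topology D f Dp Dm =
     Metric_space.mtopology D (norm_dist D (form_norm (krein_inner f Dp Dm)))"

definition continuously_embedded_krein_space ::
    "'h::complex_hilbert set \<Rightarrow> ('h \<Rightarrow> 'h \<Rightarrow> complex) \<Rightarrow> bool" where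
  "continuously_embedded_krein_space D f \<longleftrightarrow>
     krein_space D f \<and>
     (\<exists>Dp Dm. fundamental_decomposition D f Dp Dm \<and>
        continuous_map (krein_topology D f Dp Dm) euclidean (\<lambda>x. x))"

definition closed_with_gap_point ::
    "'h::complex_hilbert set \<Rightarrow> ('h \<Rightarrow> 'h \<Rightarrow> complex) \<Rightarrow> real \<Rightarrow> bool" where
  "closed_with_gap_point D \<Omega> l \<longleftrightarrow>
     continuously_embedded_krein_space D (\<lambda>x y. \<Omega> x y - complex_of_real l * cinner x y)"

subsection \<open>Reflexive Banach spaces and conjugate duals\<close>

text \<open>Functionals on \<open>V\<close> are represented by functions vanishing outside \<open>V\<close>. The dual is thereby a
  subspace of the function space with its pointwise operations, and the bidual of \<open>(V, n)\<close> is
  \<open>dual_space (dual_space V n) (dual_norm V n)\<close>.\<close>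

definition dual_space :: "'a::complex_vec set \<Rightarrow> ('a \<Rightarrow> real) \<Rightarrow> ('a \<Rightarrow> complex) set" where
  "dual_space V n = {\<phi>.
     (\<forall>x\<in>V. \<forall>y\<in>V. \<phi> (x + y) = \<phi> x + \<phi> y) \<and>
     (\<forall>a. \<forall>x\<in>V. \<phi> (a *\<^sub>C x) = a * \<phi> x) \<and>
     (\<exists>C. \<forall>x\<in>V. cmod (\<phi> x) \<le> C * n x) \<and>
     (\<forall>x. x \<notin> V \<longrightarrow> \<phi> x = 0)}"

definition dual_norm :: "'a::complex_vec set \<Rightarrow> ('a \<Rightarrow> real) \<Rightarrow> ('a \<Rightarrow> complex) \<Rightarrow> real" where
  "dual_norm V n \<phi> = (SUP x\<in>{x \<in> V. n x \<le> 1}. cmod (\<phi> x))"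

definition conj_dual_space :: "'a::complex_vec set \<Rightarrow> ('a \<Rightarrow> real) \<Rightarrow> ('a \<Rightarrow> complex) set" where
  "conj_dual_space V n = {\<Lambda>.
     (\<forall>x\<in>V. \<forall>y\<in>V. \<Lambda> (x + y) = \<Lambda> x + \<Lambda> y) \<and>
     (\<forall>a. \<forall>x\<in>V. \<Lambda> (a *\<^sub>C x) = cnj a * \<Lambda> x) \<and>
     (\<exists>C. \<forall>x\<in>V. cmod (\<Lambda> x) \<le> C * n x) \<and>
     (\<forall>x. x \<notin> V \<longrightarrow> \<Lambda> x = 0)}"

definition reflexive_banach_on :: "'a::complex_vec set \<Rightarrow> ('a \<Rightarrow> real) \<Rightarrow> bool" where
  "reflexive_banach_on V n \<longleftrightarrow>
     complex_vector.subspace V \<and> norm_on V n \<and> Metric_space.mcomplete V (norm_dist V n) \<and>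
     (\<forall>\<Phi>\<in>dual_space (dual_space V n) (dual_norm V n).
        \<exists>x\<in>V. \<forall>\<phi>\<in>dual_space V n. \<Phi> \<phi> = \<phi> x)"

subsection \<open>Q-closed and solvable forms\<close>

definition q_closed ::
    "'h::complex_hilbert set \<Rightarrow> ('h \<Rightarrow> 'h \<Rightarrow> complex) \<Rightarrow> ('h \<Rightarrow> real) \<Rightarrow> bool" where
  "q_closed D \<Omega> n \<longleftrightarrow>
     complex_vector.subspace D \<and> closure D = UNIV \<and> sesquilinear_on D \<Omega> \<and> norm_on D n \<and>
     (\<exists>\<alpha>>0. \<forall>x\<in>D. norm x \<le> \<alpha> * n x) \<and>
     (\<forall>\<xi>. Metric_space.MCauchy D (norm_dist D n) \<xi> \<and> (\<lambda>k. norm (\<xi> k)) \<longlonglongrightarrow> 0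
        \<longrightarrow> (\<lambda>k. n (\<xi> k)) \<longlonglongrightarrow> 0) \<and>
     reflexive_banach_on D n \<and>
     (\<exists>\<beta>>0. \<forall>x\<in>D. \<forall>y\<in>D. cmod (\<Omega> x y) \<le> \<beta> * n x * n y)"

definition bounded_form :: "('h::complex_hilbert \<Rightarrow> 'h \<Rightarrow> complex) \<Rightarrow> bool" where
  "bounded_form \<Upsilon> \<longleftrightarrow>
     sesquilinear_on UNIV \<Upsilon> \<and> (\<exists>C. \<forall>x y. cmod (\<Upsilon> x y) \<le> C * norm x * norm y)"

definition solving_perturbations ::
    "'h::complex_hilbert set \<Rightarrow> ('h \<Rightarrow> 'h \<Rightarrow> complex) \<Rightarrow> ('h \<Rightarrow> real) \<Rightarrow> ('h \<Rightarrow> 'h \<Rightarrow> complex) set"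
    (\<open>\<PP>\<close>) where
  "\<PP> D \<Omega> n = {\<Upsilon>. bounded_form \<Upsilon> \<and>
     (\<forall>x\<in>D. (\<forall>y\<in>D. \<Omega> x y + \<Upsilon> x y = 0) \<longrightarrow> x = 0) \<and>
     (\<forall>\<Lambda>\<in>conj_dual_space D n. \<exists>x\<in>D. \<forall>y\<in>D. \<Lambda> y = \<Omega> x y + \<Upsilon> x y)}"

definition solvable ::
    "'h::complex_hilbert set \<Rightarrow> ('h \<Rightarrow> 'h \<Rightarrow> complex) \<Rightarrow> ('h \<Rightarrow> real) \<Rightarrow> bool" where
  "solvable D \<Omega> n \<longleftrightarrow> q_closed D \<Omega> n \<and> \<PP> D \<Omega> n \<noteq> {}"

end

theory Submission
  imports Defs
begin

text \<open>A Krein space carries the Hilbert inner product \<open>[J x, y]\<close>, where \<open>J\<close> is a fundamental symmetry,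
  and Riesz' theorem for it gives solvability: \<open>\<Lambda> = [J z, \<cdot>]\<close> when \<open>z\<close> represents \<open>\<Lambda>\<close>.

  Conversely, if \<open>\<Omega>\<close> is solvable with respect to an inner product \<open>g\<close>, then
  \<open>\<Omega> - \<lambda>\<iota> = b g(T \<cdot>, \<cdot>)\<close> with \<open>b > 0\<close> and \<open>T\<close> a symmetric bijective contraction of the Hilbert space
  \<open>(D, g)\<close>. Its inverse is bounded by the theorem of Hellinger and Toeplitz. With \<open>B = |T|\<close>, the
  positive square root of \<open>T\<^sup>2\<close>, the subspaces \<open>ker (T - B)\<close> and \<open>ker (T + B)\<close> form a fundamental
  decomposition. As \<open>D\<close> is a subset rather than a type, the operator theory is carried out for
  functions on a carrier.\<close>

subsection \<open>Riesz representation and reflexivity\<close>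

text \<open>The obstacle in the converse is that condition (ii) of \<open>\<PP> D \<Omega> n\<close>
  bounds no solution by its data: together with (i) it makes T bijective but gives no lower bound on
  \<open>nrm (T x)\<close>. Uniform positivity of |T| rests on such a bound, and so does the
  completeness of the two summands. It has to be extracted from the symmetry of T, which holds
  because \<lambda> is real.

  The modulus splits D because B commutes with T and B^2 = T^2, so (T - B)(T + B) = 0; positivity of
  B then gives the form a definite sign on each kernel. A square root therefore does the work of
  spectral projections. Dividing by b makes T a contraction, so that 1 - T^2 has norm below 1, which
  is the regime where the square root is the limit of a contracting iteration.

  Uniform positivity serves twice: it makes both kernels Hilbert spaces for the form up to sign, and
  it bounds the norm of g by the Krein norm, which carries the embedding into H from the former to
  the latter. In the other direction the embedding is the source of the norm-dependent conditions
  (1), (2) and (4) on \<Omega>, while reflexivity is a property of every Hilbert space.\<close>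

locale pre_hilbert =
  fixes V :: "'a::complex_vec set" and g :: "'a \<Rightarrow> 'a \<Rightarrow> complex"
  assumes subspace: "complex_vector.subspace V"
    and inner_product: "inner_product_on V g"
begin

abbreviation nrm :: "'a \<Rightarrow> real" where "nrm \<equiv> form_norm g"

lemmas mem_0 [simp, intro] = complex_vector.subspace_0[OF subspace]
  and mem_add [simp, intro] = complex_vector.subspace_add[OF subspace]
  and mem_diff [simp, intro] = complex_vector.subspace_diff[OF subspace]
  and mem_neg [simp, intro] = complex_vector.subspace_neg[OF subspace]
  and mem_scale [simp, intro] = complex_vector.subspace_scale[OF subspace]

lemma
  assumes "x \<in> V" "y \<in> V"
  shows add_left [simp]: "z \<in> V \<Longrightarrow> g (x + y) z = g x z + g y z"
    and add_right [simp]: "z \<in> V \<Longrightarrow> g z (x + y) = g z x + g z y"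
    and scale_left [simp]: "g (a *\<^sub>C x) y = a * g x y"
    and scale_right [simp]: "g x (a *\<^sub>C y) = cnj a * g x y"
  using inner_product assms by (auto simp: inner_product_on_def sesquilinear_on_def)

lemma commute: "x \<in> V \<Longrightarrow> y \<in> V \<Longrightarrow> cnj (g x y) = g y x"
  using inner_product unfolding inner_product_on_def symmetric_on_def by metis

lemma zero_left [simp]: "x \<in> V \<Longrightarrow> g 0 x = 0"
  using scale_left[of x x 0] by simp

lemma zero_right [simp]: "x \<in> V \<Longrightarrow> g x 0 = 0"
  using scale_right[of x x 0] by simp

lemma
  assumes "x \<in> V" "y \<in> V"
  shows neg_left [simp]: "g (- x) y = - g x y"
    and neg_right [simp]: "g x (- y) = - g x y"
  using scale_left[OF assms, of "-1"] scale_right[OF assms, of "-1"] by simp_all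

lemma
  assumes "x \<in> V" "y \<in> V" "z \<in> V"
  shows diff_left [simp]: "g (x - y) z = g x z - g y z"
    and diff_right [simp]: "g z (x - y) = g z x - g z y"
  using add_left[of x "- y" z] add_right[of x "- y" z] assms by simp_all

lemma norm_on: "norm_on V nrm"
  by (rule norm_on_form_norm[OF subspace inner_product])

lemma nrm_ge_0 [simp]: "x \<in> V \<Longrightarrow> 0 \<le> nrm x"
  and nrm_eq_0_iff [simp]: "x \<in> V \<Longrightarrow> nrm x = 0 \<longleftrightarrow> x = 0"
  and nrm_triangle: "x \<in> V \<Longrightarrow> y \<in> V \<Longrightarrow> nrm (x + y) \<le> nrm x + nrm y"
  and nrm_scale [simp]: "x \<in> V \<Longrightarrow> nrm (a *\<^sub>C x) = cmod a * nrm x"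
  using norm_on unfolding norm_on_def by blast+

lemma nrm_0 [simp]: "nrm 0 = 0"
  by simp

lemma nrm_pos: "x \<in> V \<Longrightarrow> x \<noteq> 0 \<Longrightarrow> 0 < nrm x"
  using nrm_ge_0[of x] nrm_eq_0_iff[of x] by linarith

lemma nrm_neg [simp]: "x \<in> V \<Longrightarrow> nrm (- x) = nrm x"
  using nrm_scale[of x "-1"] by simp

lemma nrm_diff_commute: "x \<in> V \<Longrightarrow> y \<in> V \<Longrightarrow> nrm (x - y) = nrm (y - x)"
  using nrm_neg[of "x - y"] by simp

lemma nrm_diff_le: "x \<in> V \<Longrightarrow> y \<in> V \<Longrightarrow> nrm (x - y) \<le> nrm x + nrm y"
  using nrm_triangle[of x "- y"] by simp

lemma nrm_diff_triangle:
  "x \<in> V \<Longrightarrow> y \<in> V \<Longrightarrow> z \<in> V \<Longrightarrow> nrm (x - z) \<le> nrm (x - y) + nrm (y - z)"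
  using nrm_triangle[of "x - y" "y - z"] by simp

lemma nrm_reverse_triangle: "x \<in> V \<Longrightarrow> y \<in> V \<Longrightarrow> \<bar>nrm x - nrm y\<bar> \<le> nrm (x - y)"
  using nrm_triangle[of "x - y" y] nrm_triangle[of "y - x" x] nrm_diff_commute[of x y] by simp

lemma self_nonneg: "x \<in> V \<Longrightarrow> 0 \<le> Re (g x x)"
  using inner_product by (cases "x = 0") (force simp: inner_product_on_def)+

lemma nrm_sq: "x \<in> V \<Longrightarrow> (nrm x)\<^sup>2 = Re (g x x)"
  by (simp add: form_norm_def self_nonneg)

lemma self_eq: "x \<in> V \<Longrightarrow> g x x = of_real ((nrm x)\<^sup>2)"
  using commute[of x x] by (simp add: nrm_sq complex_eq_iff)

lemma nrm_sq_add:
  assumes "x \<in> V" "y \<in> V"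
  shows "(nrm (x + y))\<^sup>2 = (nrm x)\<^sup>2 + 2 * Re (g x y) + (nrm y)\<^sup>2"
proof -
  have "Re (g y x) = Re (g x y)" using commute[OF assms] by (metis complex_cnj(1) complex.sel(1) complex.exhaust_sel)
  then show ?thesis using assms by (simp add: nrm_sq)
qed

lemma nrm_sq_diff:
  "x \<in> V \<Longrightarrow> y \<in> V \<Longrightarrow> (nrm (x - y))\<^sup>2 = (nrm x)\<^sup>2 - 2 * Re (g x y) + (nrm y)\<^sup>2"
  using nrm_sq_add[of x "- y"] by simp

lemma Cauchy_Schwarz:
  assumes x: "x \<in> V" and y: "y \<in> V"
  shows "cmod (g x y) \<le> nrm x * nrm y"
proof (cases "y = 0")
  case True
  then show ?thesis using x by simp
next
  case False
  define c where "c = (nrm y)\<^sup>2"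
  have c: "c > 0" using False y nrm_pos[of y] by (simp add: c_def)
  \<comment> \<open>\<open>w\<close> is the orthogonal projection of \<open>x\<close> onto the line
    through \<open>y\<close>. Both \<open>g x w\<close> and the square of \<open>nrm w\<close> equal
    |g x y|^2 / c, so the inequality is \<open>nrm (x - w)\<close> squared being
    nonnegative.\<close>
  define w where "w = (g x y / of_real c) *\<^sub>C y"
  have w: "w \<in> V" using y by (simp add: w_def)
  have "g x w = of_real ((cmod (g x y))\<^sup>2 / c)"
    unfolding w_def using x y by (simp add: mult.commute[of "cnj _"] complex_mult_cnj cmod_power2)
  then have 1: "Re (g x w) = (cmod (g x y))\<^sup>2 / c" by simp
  have 2: "(nrm w)\<^sup>2 = (cmod (g x y))\<^sup>2 / c"
  proof -
    have "nrm w = cmod (g x y) / c * nrm y"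
      unfolding w_def using y c by (simp add: norm_divide)
    then have "(nrm w)\<^sup>2 = (cmod (g x y))\<^sup>2 / c\<^sup>2 * c"
      by (simp add: power_mult_distrib power_divide c_def)
    then show ?thesis using c by (simp add: power2_eq_square)
  qed
  have "0 \<le> (nrm (x - w))\<^sup>2" by simp
  then have "(cmod (g x y))\<^sup>2 / c \<le> (nrm x)\<^sup>2"
    using nrm_sq_diff[OF x w] 1 2 by simp
  then have "(cmod (g x y))\<^sup>2 \<le> (nrm x * nrm y)\<^sup>2"
    using c by (simp add: field_simps c_def)
  then show ?thesis using x y by (simp add: power2_le_iff_abs_le)
qed

lemma eqI:
  assumes "x \<in> V" "y \<in> V" "\<And>z. z \<in> V \<Longrightarrow> g x z = g y z"
  shows "x = y"
proof -
  have "(nrm (x - y))\<^sup>2 = 0" using assms nrm_sq[of "x - y"] by simp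
  then show ?thesis using assms by simp
qed

lemma limit_unique:
  assumes "\<And>k. s k \<in> V" "a \<in> V" "b \<in> V"
    and "(\<lambda>k. nrm (s k - a)) \<longlonglongrightarrow> 0" "(\<lambda>k. nrm (s k - b)) \<longlonglongrightarrow> 0"
  shows "a = b"
proof -
  have "(\<lambda>k. nrm (s k - a) + nrm (s k - b)) \<longlonglongrightarrow> 0 + 0"
    by (intro tendsto_add assms)
  moreover have "nrm (a - b) \<le> nrm (s k - a) + nrm (s k - b)" for k
    using nrm_diff_triangle[of a "s k" b] nrm_diff_commute[of a "s k"] assms by simp
  ultimately have "nrm (a - b) \<le> 0"
    by (intro LIMSEQ_le_const[of _ 0]) auto
  then have "nrm (a - b) = 0" using assms by (intro antisym) simp_all
  then show ?thesis using assms by simp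
qed

lemma tendsto_nrm:
  assumes "\<And>k. s k \<in> V" "a \<in> V" "(\<lambda>k. nrm (s k - a)) \<longlonglongrightarrow> 0"
  shows "(\<lambda>k. nrm (s k)) \<longlonglongrightarrow> nrm a"
proof -
  have "(\<lambda>k. nrm (s k) - nrm a) \<longlonglongrightarrow> 0"
    by (rule Lim_null_comparison[OF _ assms(3)]) (use nrm_reverse_triangle assms in auto)
  then show ?thesis using LIM_zero_iff by blast
qed

lemma tendsto_inner:
  assumes s: "\<And>k. s k \<in> V" and a: "a \<in> V" and y: "y \<in> V" and "(\<lambda>k. nrm (s k - a)) \<longlonglongrightarrow> 0"
  shows "(\<lambda>k. g (s k) y) \<longlonglongrightarrow> g a y"
proof -
  have *: "(\<lambda>k. nrm (s k - a) * nrm y) \<longlonglongrightarrow> 0" by (rule tendsto_mult_left_zero[OF assms(4)])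
  have "cmod (g (s k) y - g a y) \<le> nrm (s k - a) * nrm y" for k
    using Cauchy_Schwarz[of "s k - a" y] s a y by simp
  then have "(\<lambda>k. g (s k) y - g a y) \<longlonglongrightarrow> 0"
    by (intro Lim_null_comparison[OF _ *] always_eventually) blast
  then show ?thesis by (rule LIM_zero_cancel)
qed

end

section \<open>Completeness of a carrier in terms of sequences\<close>

definition cauchy_wrt :: "('a::ab_group_add \<Rightarrow> real) \<Rightarrow> (nat \<Rightarrow> 'a) \<Rightarrow> bool" where
  "cauchy_wrt n s \<longleftrightarrow> (\<forall>e>0. \<exists>k. \<forall>i\<ge>k. \<forall>j\<ge>k. n (s i - s j) < e)"

text \<open>The default value 0 of \<open>norm_dist\<close> is harmless because Cauchy sequences and
  their limits stay in \<open>V\<close>. Afterwards completeness can be handled without metric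
  spaces.\<close>

lemma mcomplete_norm_dist_iff:
  fixes V :: "'a::complex_vec set"
  assumes V: "complex_vector.subspace V" and n: "norm_on V n"
  shows "Metric_space.mcomplete V (norm_dist V n) \<longleftrightarrow>
    (\<forall>s. (\<forall>k. s k \<in> V) \<and> cauchy_wrt n s \<longrightarrow> (\<exists>a\<in>V. (\<lambda>k. n (s k - a)) \<longlonglongrightarrow> 0))"
proof -
  interpret M: Metric_space V "norm_dist V n" by (rule Metric_space_norm_dist[OF V n])
  have C: "M.MCauchy s \<longleftrightarrow> (\<forall>k. s k \<in> V) \<and> cauchy_wrt n s" for s
    unfolding M.MCauchy_def cauchy_wrt_def norm_dist_def
    by (auto simp: image_subset_iff)
  have L: "limitin M.mtopology s a sequentially \<longleftrightarrow> a \<in> V \<and> (\<lambda>k. n (s k - a)) \<longlonglongrightarrow> 0"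
    if s: "\<And>k. s k \<in> V" for s a
  proof (cases "a \<in> V")
    case True
    have "0 \<le> n (s k - a)" for k
      using n s True complex_vector.subspace_diff[OF V] unfolding norm_on_def by blast
    then show ?thesis
      using True s by (auto simp: M.limit_metric_sequentially LIMSEQ_def norm_dist_def)
  next
    case False
    then show ?thesis by (simp add: M.limit_metric_sequentially)
  qed
  show ?thesis unfolding M.mcomplete_def using C L by blast
qed

text \<open>Norm and sequence change together, which covers both the passage to an equivalent norm
  and the passage from a sequence to its components in a direct sum.\<close>

lemma cauchy_wrt_mono:
  assumes "cauchy_wrt n s" "C > 0" "\<And>i j. m (t i - t j) \<le> C * n (s i - s j)"
  shows "cauchy_wrt m t"
  unfolding cauchy_wrt_def
proof (intro allI impI)
  fix e :: real assume "e > 0"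
  then obtain k where k: "\<And>i j. i \<ge> k \<Longrightarrow> j \<ge> k \<Longrightarrow> n (s i - s j) < e / C"
    using assms(1,2) unfolding cauchy_wrt_def by (meson divide_pos_pos)
  have "m (t i - t j) < e" if "i \<ge> k" "j \<ge> k" for i j
    using k[OF that] assms(2) assms(3)[of i j] by (simp add: field_simps)
  then show "\<exists>k. \<forall>i\<ge>k. \<forall>j\<ge>k. m (t i - t j) < e" by blast
qed

locale hilbert = pre_hilbert +
  assumes complete: "\<And>s. (\<And>k. s k \<in> V) \<Longrightarrow> cauchy_wrt nrm s \<Longrightarrow> \<exists>a\<in>V. (\<lambda>k. nrm (s k - a)) \<longlonglongrightarrow> 0"

lemma hilbert_on_iff: "hilbert_on V g \<longleftrightarrow> hilbert V g"
proof
  assume h: "hilbert_on V g"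
  then have 1: "complex_vector.subspace V" "inner_product_on V g"
    by (auto simp: hilbert_on_def)
  then show "hilbert V g"
    using h mcomplete_norm_dist_iff[OF 1(1) norm_on_form_norm[OF 1]]
    by unfold_locales (auto simp: hilbert_on_def)
next
  assume "hilbert V g"
  then interpret hilbert V g .
  show "hilbert_on V g"
    unfolding hilbert_on_def mcomplete_norm_dist_iff[OF subspace norm_on]
    using complete subspace inner_product by blast
qed

section \<open>Functionals on a Hilbert carrier\<close>

context hilbert
begin

text \<open>The representing vector minimises \<open>\<parallel>x\<parallel>\<^sup>2 - 2 Re (\<phi> x)\<close>.\<close>

lemma Riesz_representation:
  assumes add: "\<And>x y. x \<in> V \<Longrightarrow> y \<in> V \<Longrightarrow> \<phi> (x + y) = \<phi> x + \<phi> y"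
    and sc: "\<And>a x. x \<in> V \<Longrightarrow> \<phi> (a *\<^sub>C x) = a * \<phi> x"
    and bd: "\<And>x. x \<in> V \<Longrightarrow> cmod (\<phi> x) \<le> C * nrm x"
  obtains z where "z \<in> V" "\<And>x. x \<in> V \<Longrightarrow> \<phi> x = g x z"
proof -
  define F where "F x = (nrm x)\<^sup>2 - 2 * Re (\<phi> x)" for x
  have F_ge: "F x \<ge> - C\<^sup>2" if "x \<in> V" for x
  proof -
    have "Re (\<phi> x) \<le> C * nrm x" using bd[OF that] complex_Re_le_cmod[of "\<phi> x"] by linarith
    moreover have "0 \<le> (nrm x - C)\<^sup>2" by simp
    ultimately show ?thesis by (simp add: F_def power2_diff mult.commute)
  qed
  define m where "m = (INF x\<in>V. F x)"
  have bddF: "bdd_below (F ` V)" using F_ge by (auto intro!: bdd_belowI2)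
  have m_le: "m \<le> F x" if "x \<in> V" for x
    unfolding m_def using bddF that by (rule cINF_lower)
  have "\<exists>x\<in>V. F x < m + 1 / Suc k" for k
  proof -
    have "V \<noteq> {}" using mem_0 by blast
    then show ?thesis
      using cINF_less_iff[OF _ bddF, of "m + 1 / Suc k"] by (simp add: m_def)
  qed
  then obtain s where s: "\<And>k. s k \<in> V" and Fs: "\<And>k. F (s k) < m + 1 / Suc k" by metis
  \<comment> \<open>Parallelogram law: the midpoint \<open>h\<close> satisfies
    \<open>F h \<ge> m\<close>, so two points at which \<open>F\<close> is nearly minimal must be
    close to each other.\<close>
  have par: "(nrm (x - y))\<^sup>2 \<le> 2 * F x - 2 * m + 2 * F y - 2 * m" if "x \<in> V" "y \<in> V" for x y
  proof -
    define h where "h = (1/2) *\<^sub>C (x + y)"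
    have h: "h \<in> V" using that by (simp add: h_def)
    have "Re (\<phi> h) = (Re (\<phi> x) + Re (\<phi> y)) / 2" using that by (simp add: h_def add sc)
    moreover have "(nrm h)\<^sup>2 = (nrm (x + y))\<^sup>2 / 4"
      using that by (simp add: h_def power_mult_distrib norm_divide power_divide)
    ultimately have "4 * F h = (nrm (x + y))\<^sup>2 - 4 * Re (\<phi> x) - 4 * Re (\<phi> y)"
      by (simp add: F_def)
    moreover have "(nrm (x + y))\<^sup>2 + (nrm (x - y))\<^sup>2 = 2 * (nrm x)\<^sup>2 + 2 * (nrm y)\<^sup>2"
      using that by (simp add: nrm_sq_add nrm_sq_diff)
    ultimately have "(nrm (x - y))\<^sup>2 = 2 * F x + 2 * F y - 4 * F h"
      by (simp add: F_def)
    then show ?thesis using m_le[OF h] by linarith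
  qed
  have "cauchy_wrt nrm s"
    unfolding cauchy_wrt_def
  proof (intro allI impI)
    fix e :: real assume e: "e > 0"
    then obtain k where k: "inverse (Suc k) < e\<^sup>2 / 4"
      using reals_Archimedean[of "e\<^sup>2 / 4"] by auto
    have "nrm (s i - s j) < e" if "i \<ge> k" "j \<ge> k" for i j
    proof -
      have *: "F (s i) - m < inverse (Suc k)" if "i \<ge> k" for i
      proof -
        have "1 / real (Suc i) \<le> inverse (Suc k)" using that by (simp add: field_simps)
        then show ?thesis using Fs[of i] by linarith
      qed
      have "(nrm (s i - s j))\<^sup>2 < e\<^sup>2"
        using par[OF s[of i] s[of j]] *[OF that(1)] *[OF that(2)] k by linarith
      then show ?thesis using e by (simp add: power2_less_imp_less)
    qed
    then show "\<exists>k. \<forall>i\<ge>k. \<forall>j\<ge>k. nrm (s i - s j) < e" by blast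
  qed
  then obtain z where z: "z \<in> V" and lim: "(\<lambda>k. nrm (s k - z)) \<longlonglongrightarrow> 0"
    using complete s by blast
  have "(\<lambda>k. \<phi> (s k) - \<phi> z) \<longlonglongrightarrow> 0"
  proof (rule Lim_null_comparison)
    have "\<phi> (s k) = \<phi> (s k - z) + \<phi> z" for k using add[of "s k - z" z] s z by simp
    then show "\<forall>\<^sub>F k in sequentially. norm (\<phi> (s k) - \<phi> z) \<le> C * nrm (s k - z)"
      using bd s z by simp
    show "(\<lambda>k. C * nrm (s k - z)) \<longlonglongrightarrow> 0" using tendsto_mult_right_zero[OF lim] by simp
  qed
  then have "(\<lambda>k. \<phi> (s k)) \<longlonglongrightarrow> \<phi> z" using LIM_zero_iff by blast
  then have "(\<lambda>k. F (s k)) \<longlonglongrightarrow> F z"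
    unfolding F_def by (intro tendsto_intros tendsto_nrm s z lim)
  moreover have "(\<lambda>k. m + 1 / Suc k) \<longlonglongrightarrow> m + 0"
    by (intro tendsto_intros LIMSEQ_Suc[OF lim_1_over_n])
  ultimately have Fz: "F z \<le> m"
    using Fs by (intro LIMSEQ_le[of "\<lambda>k. F (s k)" _ "\<lambda>k. m + 1 / Suc k"]) (auto intro: less_imp_le)
  have Re_eq: "Re (\<phi> y) = Re (g y z)" if y: "y \<in> V" for y
  proof (rule ccontr)
    define d where "d = Re (g y z) - Re (\<phi> y)"
    assume "Re (\<phi> y) \<noteq> Re (g y z)"
    then have d: "d \<noteq> 0" by (simp add: d_def)
    \<comment> \<open>First variation at the minimiser in direction \<open>y\<close>. The summand 1
      keeps \<open>c\<close> positive even for \<open>y = 0\<close>, and \<open>t = - d / c\<close>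
      minimises the upper bound 2 t d + t^2 c, whose value -d^2/c is negative.\<close>
    define c where "c = (nrm y)\<^sup>2 + 1"
    have c: "c > 0" by (simp add: c_def add_nonneg_pos)
    define t where "t = - d / c"
    define w where "w = of_real t *\<^sub>C y"
    have w: "w \<in> V" using y by (simp add: w_def)
    have "F z \<le> F (w + z)" using Fz m_le[of "w + z"] w z by simp
    also have "F (w + z) = F z + 2 * t * d + t\<^sup>2 * (nrm y)\<^sup>2"
      using w z y unfolding F_def
      by (simp add: nrm_sq_add add) (simp add: w_def sc power_mult_distrib d_def algebra_simps)
    finally have "0 \<le> 2 * t * d + t\<^sup>2 * (nrm y)\<^sup>2" by simp
    also have "\<dots> \<le> 2 * t * d + t\<^sup>2 * c" by (simp add: c_def mult_left_mono)
    also have "\<dots> = - (d\<^sup>2 / c)" using c by (simp add: t_def power2_eq_square field_simps)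
    finally show False using c d by (simp add: divide_le_0_iff)
  qed
  have "\<phi> y = g y z" if y: "y \<in> V" for y
  proof (rule complex_eqI)
    show "Re (\<phi> y) = Re (g y z)" by (rule Re_eq[OF y])
    show "Im (\<phi> y) = Im (g y z)" using Re_eq[of "\<i> *\<^sub>C y"] y z by (simp add: sc)
  qed
  with z that show ?thesis by blast
qed

lemma Riesz_representation_conj:
  assumes add: "\<And>x y. x \<in> V \<Longrightarrow> y \<in> V \<Longrightarrow> \<phi> (x + y) = \<phi> x + \<phi> y"
    and sc: "\<And>a x. x \<in> V \<Longrightarrow> \<phi> (a *\<^sub>C x) = cnj a * \<phi> x"
    and bd: "\<And>x. x \<in> V \<Longrightarrow> cmod (\<phi> x) \<le> C * nrm x"
  obtains z where "z \<in> V" "\<And>x. x \<in> V \<Longrightarrow> \<phi> x = g z x"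
proof -
  obtain z where z: "z \<in> V" and *: "\<And>x. x \<in> V \<Longrightarrow> cnj (\<phi> x) = g x z"
    by (rule Riesz_representation[of "\<lambda>x. cnj (\<phi> x)" C]) (simp_all add: add sc bd)
  have "\<phi> x = g z x" if "x \<in> V" for x
    using *[OF that] commute[OF that z] by (metis complex_cnj_cnj)
  with z that show ?thesis by blast
qed

text \<open>Riesz identifies \<open>V\<close> with its dual by the conjugate linear map
  \<open>F\<close>. Composing \<Phi> with it gives a bounded conjugate linear functional on
  \<open>V\<close>, and the vector representing that functional is the one that \<Phi> evaluates
  at.\<close>

lemma reflexive: "reflexive_banach_on V nrm"
  unfolding reflexive_banach_on_def
proof (intro conjI ballI subspace norm_on)
  show "Metric_space.mcomplete V (norm_dist V nrm)"
    unfolding mcomplete_norm_dist_iff[OF subspace norm_on] using complete by blast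
  fix \<Phi> assume \<Phi>: "\<Phi> \<in> dual_space (dual_space V nrm) (dual_norm V nrm)"
  \<comment> \<open>Extension by 0 matches the convention of \<open>dual_space\<close>, so that a
    functional represented by \<open>z\<close> is equal to \<open>F z\<close> as a function.\<close>
  define F where "F z = (\<lambda>y. if y \<in> V then g y z else 0)" for z
  have F: "F z \<in> dual_space V nrm" if z: "z \<in> V" for z
  proof -
    have "cmod (F z y) \<le> nrm z * nrm y" if "y \<in> V" for y
      using Cauchy_Schwarz[OF that z] that by (simp add: F_def mult.commute)
    then show ?thesis using z unfolding dual_space_def by (auto simp: F_def)
  qed
  \<comment> \<open>Membership in \<open>dual_space\<close> may come with a negative constant
    \<open>C\<close>. Since the dual norm is nonnegative here, \<open>C\<close> can be replaced by
    its absolute value before the upper bound is inserted.\<close>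
  have F_norm: "0 \<le> dual_norm V nrm (F z)" "dual_norm V nrm (F z) \<le> nrm z" if z: "z \<in> V" for z
  proof -
    have le: "cmod (F z y) \<le> nrm z" if y: "y \<in> {y \<in> V. nrm y \<le> 1}" for y
    proof -
      have "cmod (F z y) \<le> nrm y * nrm z" using Cauchy_Schwarz z y by (simp add: F_def)
      also have "\<dots> \<le> 1 * nrm z" using y z by (intro mult_right_mono) auto
      finally show ?thesis by simp
    qed
    show "dual_norm V nrm (F z) \<le> nrm z"
      unfolding dual_norm_def by (rule cSUP_least) (use le in auto)
    have "cmod (F z 0) \<le> dual_norm V nrm (F z)"
      unfolding dual_norm_def by (rule cSUP_upper) (auto intro!: bdd_aboveI2[of _ _ "nrm z"] le)
    then show "0 \<le> dual_norm V nrm (F z)" by (meson norm_ge_zero order_trans)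
  qed
  obtain C where C: "\<And>\<phi>. \<phi> \<in> dual_space V nrm \<Longrightarrow> cmod (\<Phi> \<phi>) \<le> C * dual_norm V nrm \<phi>"
    using \<Phi> unfolding dual_space_def[of "dual_space V nrm"] by blast
  have \<Phi>_add: "\<Phi> (p + r) = \<Phi> p + \<Phi> r" if "p \<in> dual_space V nrm" "r \<in> dual_space V nrm" for p r
    using \<Phi> that unfolding dual_space_def[of "dual_space V nrm"] by blast
  have \<Phi>_scale: "\<Phi> (a *\<^sub>C p) = a * \<Phi> p" if "p \<in> dual_space V nrm" for a p
    using \<Phi> that unfolding dual_space_def[of "dual_space V nrm"] by blast
  obtain x where x: "x \<in> V" and eq: "\<And>z. z \<in> V \<Longrightarrow> \<Phi> (F z) = g x z"
  proof (rule Riesz_representation_conj[of "\<lambda>z. \<Phi> (F z)" "\<bar>C\<bar>"])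
    show "\<Phi> (F (z + w)) = \<Phi> (F z) + \<Phi> (F w)" if "z \<in> V" "w \<in> V" for z w
    proof -
      have "F (z + w) = F z + F w" using that by (auto simp: F_def fun_eq_iff)
      then show ?thesis using \<Phi>_add F that by simp
    qed
    show "\<Phi> (F (a *\<^sub>C z)) = cnj a * \<Phi> (F z)" if "z \<in> V" for a z
    proof -
      have "F (a *\<^sub>C z) = cnj a *\<^sub>C F z"
        using that by (auto simp: F_def fun_eq_iff scaleC_fun_def scaleC_complex_def)
      then show ?thesis using \<Phi>_scale F that by simp
    qed
    show "cmod (\<Phi> (F z)) \<le> \<bar>C\<bar> * nrm z" if "z \<in> V" for z
    proof -
      have "cmod (\<Phi> (F z)) \<le> \<bar>C\<bar> * dual_norm V nrm (F z)"
        using C[OF F[OF that]] F_norm[OF that] by (meson abs_ge_self mult_right_mono order_trans)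
      also have "\<dots> \<le> \<bar>C\<bar> * nrm z" using F_norm[OF that] by (intro mult_left_mono) auto
      finally show ?thesis .
    qed
  qed blast
  show "\<exists>x\<in>V. \<forall>\<phi>\<in>dual_space V nrm. \<Phi> \<phi> = \<phi> x"
  proof (intro bexI[OF _ x] ballI)
    fix \<phi> assume \<phi>: "\<phi> \<in> dual_space V nrm"
    then obtain K where K: "\<forall>y\<in>V. cmod (\<phi> y) \<le> K * nrm y"
      and lin: "\<forall>x\<in>V. \<forall>y\<in>V. \<phi> (x + y) = \<phi> x + \<phi> y" "\<forall>a. \<forall>x\<in>V. \<phi> (a *\<^sub>C x) = a * \<phi> x"
      unfolding dual_space_def by blast
    obtain z where z: "z \<in> V" and \<phi>z: "\<And>y. y \<in> V \<Longrightarrow> \<phi> y = g y z"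
      by (rule Riesz_representation[of \<phi> K]) (use K lin in blast)+
    have "\<phi> = F z" using \<phi> \<phi>z by (auto simp: F_def fun_eq_iff dual_space_def)
    then show "\<Phi> \<phi> = \<phi> x" using eq[OF z] \<phi>z[OF x] by simp
  qed
qed

end

subsection \<open>Symmetric operators and their moduli\<close>

text \<open>The fixed point equation 2 Y = E + Y^2 is (1 - Y)^2 = 1 - E rearranged, so the iteration
  started at 0 aims at 1 - sqrt (1 - E).\<close>

primrec one_minus_sqrt_iter :: "('a \<Rightarrow> 'a) \<Rightarrow> nat \<Rightarrow> 'a \<Rightarrow> 'a::complex_vec" where
  "one_minus_sqrt_iter E 0 = (\<lambda>x. 0)"
| "one_minus_sqrt_iter E (Suc n) =
     (\<lambda>x. (1/2) *\<^sub>C (E x + one_minus_sqrt_iter E n (one_minus_sqrt_iter E n x)))"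

section \<open>Operators on a carrier and equivalent forms on subspaces\<close>

context pre_hilbert
begin

definition linear_op :: "('a \<Rightarrow> 'a) \<Rightarrow> bool" where
  "linear_op A \<longleftrightarrow> (\<forall>x\<in>V. A x \<in> V) \<and> (\<forall>x\<in>V. \<forall>y\<in>V. A (x + y) = A x + A y) \<and>
     (\<forall>a. \<forall>x\<in>V. A (a *\<^sub>C x) = a *\<^sub>C A x)"

definition symmetric_op :: "('a \<Rightarrow> 'a) \<Rightarrow> bool" where
  "symmetric_op A \<longleftrightarrow> (\<forall>x\<in>V. \<forall>y\<in>V. g (A x) y = g x (A y))"

definition bounded_op :: "real \<Rightarrow> ('a \<Rightarrow> 'a) \<Rightarrow> bool" where
  "bounded_op K A \<longleftrightarrow> (\<forall>x\<in>V. nrm (A x) \<le> K * nrm x)"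

lemma linear_opI:
  assumes "\<And>x. x \<in> V \<Longrightarrow> A x \<in> V" "\<And>x y. x \<in> V \<Longrightarrow> y \<in> V \<Longrightarrow> A (x + y) = A x + A y"
    "\<And>a x. x \<in> V \<Longrightarrow> A (a *\<^sub>C x) = a *\<^sub>C A x"
  shows "linear_op A"
  using assms by (simp add: linear_op_def)

lemma
  assumes "linear_op A" and "x \<in> V"
  shows op_mem: "A x \<in> V"
    and op_add: "y \<in> V \<Longrightarrow> A (x + y) = A x + A y"
    and op_scale: "A (a *\<^sub>C x) = a *\<^sub>C A x"
  using assms by (auto simp: linear_op_def)

lemma op_neg: "linear_op A \<Longrightarrow> x \<in> V \<Longrightarrow> A (- x) = - A x"
  using op_scale[of A x "-1"] by simp

lemma op_diff: "linear_op A \<Longrightarrow> x \<in> V \<Longrightarrow> y \<in> V \<Longrightarrow> A (x - y) = A x - A y"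
  using op_add[of A x "- y"] by (simp add: op_neg)

lemma op_zero: "linear_op A \<Longrightarrow> A 0 = 0"
  using op_scale[of A 0 0] by simp

lemma linear_op_compose: "linear_op A \<Longrightarrow> linear_op B \<Longrightarrow> linear_op (\<lambda>x. A (B x))"
  by (rule linear_opI) (simp_all add: op_mem op_add op_scale)

lemma linear_op_diff: "linear_op A \<Longrightarrow> linear_op B \<Longrightarrow> linear_op (\<lambda>x. A x - B x)"
  by (rule linear_opI) (simp_all add: op_mem op_add op_scale complex_vector.scale_right_diff_distrib)

lemma linear_op_neg: "linear_op A \<Longrightarrow> linear_op (\<lambda>x. - A x)"
  by (rule linear_opI) (simp_all add: op_mem op_add op_scale)

lemma linear_op_id: "linear_op (\<lambda>x. x)"
  by (rule linear_opI) simp_all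

lemma bounded_op_compose:
  assumes "linear_op B" "bounded_op K A" "bounded_op M B" "0 \<le> K" "x \<in> V"
  shows "nrm (A (B x)) \<le> K * (M * nrm x)"
proof -
  have "nrm (A (B x)) \<le> K * nrm (B x)" using assms op_mem by (simp add: bounded_op_def)
  also have "\<dots> \<le> K * (M * nrm x)" using assms by (intro mult_left_mono) (auto simp: bounded_op_def)
  finally show ?thesis .
qed

lemma op_limit:
  assumes A: "linear_op A" "bounded_op K A" and s: "\<And>k. s k \<in> V" and a: "a \<in> V"
    and lim: "(\<lambda>k. nrm (s k - a)) \<longlonglongrightarrow> 0"
  shows "(\<lambda>k. nrm (A (s k) - A a)) \<longlonglongrightarrow> 0"
proof -
  have *: "(\<lambda>k. K * nrm (s k - a)) \<longlonglongrightarrow> 0" by (rule tendsto_mult_right_zero[OF lim])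
  have "nrm (A (s k) - A a) \<le> K * nrm (s k - a)" for k
    using A s a op_diff[of A "s k" a] by (metis bounded_op_def mem_diff)
  then have "norm (nrm (A (s k) - A a)) \<le> K * nrm (s k - a)" for k
    using A s a by (simp add: op_mem)
  then show ?thesis by (intro Lim_null_comparison[OF _ *] always_eventually) blast
qed

text \<open>The constants \<open>d\<close> and \<open>M\<close> make the norms of \<open>h\<close>
  and \<open>g\<close> equivalent on \<open>W\<close>, so completeness passes from one to the other.
  This will turn the two kernels into Hilbert spaces for the form and for its negative.\<close>

lemma hilbert_on_closed_subspace:
  assumes W: "complex_vector.subspace W" "W \<subseteq> V" and h: "sesquilinear_on W h" "symmetric_on W h"
    and d: "0 < d" "\<And>x. x \<in> W \<Longrightarrow> d * (nrm x)\<^sup>2 \<le> Re (h x x)"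
    and M: "\<And>x. x \<in> W \<Longrightarrow> Re (h x x) \<le> M * (nrm x)\<^sup>2"
    and limit: "\<And>s. (\<And>k. s k \<in> W) \<Longrightarrow> cauchy_wrt nrm s \<Longrightarrow> \<exists>a\<in>W. (\<lambda>k. nrm (s k - a)) \<longlonglongrightarrow> 0"
  shows "hilbert_on W h"
proof -
  have "0 < Re (h x x)" if "x \<in> W" "x \<noteq> 0" for x
  proof -
    have "x \<in> V" using W that by blast
    then have "0 < d * (nrm x)\<^sup>2" using d(1) that by simp
    then show ?thesis using d(2)[OF that(1)] by linarith
  qed
  then have ip: "inner_product_on W h" using h by (simp add: inner_product_on_def)
  interpret W: pre_hilbert W h using W(1) ip by unfold_locales
  have lower: "nrm x \<le> (1 / sqrt d) * W.nrm x" if "x \<in> W" for x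
  proof -
    have x: "x \<in> V" using W that by blast
    have "sqrt (d * (nrm x)\<^sup>2) \<le> sqrt (Re (h x x))" using d(2)[OF that] by simp
    then have "sqrt d * nrm x \<le> W.nrm x" using x by (simp add: real_sqrt_mult form_norm_def[of h])
    then show ?thesis using d(1) by (simp add: field_simps)
  qed
  have upper: "W.nrm x \<le> sqrt M * nrm x" if "x \<in> W" for x
  proof -
    have x: "x \<in> V" using W that by blast
    have "sqrt (Re (h x x)) \<le> sqrt (M * (nrm x)\<^sup>2)" using M that by simp
    then show ?thesis using x by (simp add: real_sqrt_mult form_norm_def[of h])
  qed
  have "hilbert W h"
  proof
    fix s assume s: "\<And>k. s k \<in> W" and c: "cauchy_wrt W.nrm s"
    have "cauchy_wrt nrm s"
      by (rule cauchy_wrt_mono[OF c, of "1 / sqrt d"]) (use d lower s in auto)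
    then obtain a where a: "a \<in> W" and lim: "(\<lambda>k. nrm (s k - a)) \<longlonglongrightarrow> 0" using limit s by blast
    have *: "(\<lambda>k. sqrt M * nrm (s k - a)) \<longlonglongrightarrow> 0" by (rule tendsto_mult_right_zero[OF lim])
    have "norm (W.nrm (s k - a)) \<le> sqrt M * nrm (s k - a)" for k
      using upper[of "s k - a"] s a by simp
    then have "(\<lambda>k. W.nrm (s k - a)) \<longlonglongrightarrow> 0"
      by (intro Lim_null_comparison[OF _ *] always_eventually) blast
    with a show "\<exists>a\<in>W. (\<lambda>k. W.nrm (s k - a)) \<longlonglongrightarrow> 0" by blast
  qed
  then show ?thesis by (simp add: hilbert_on_iff)
qed

end

section \<open>Geometric limits, the Hellinger-Toeplitz theorem and positive square roots\<close>

context hilbert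
begin

text \<open>The square root iteration uses only the convergence. The explicit tail bound is there
  for the gliding hump, where the later steps have to be weighed against the current one.\<close>

lemma geometric_limit:
  assumes s: "\<And>k. s k \<in> V" and r: "0 \<le> r" "r < 1" and C: "0 \<le> C"
    and step: "\<And>k. nrm (s (Suc k) - s k) \<le> C * r ^ k"
  obtains a where "a \<in> V" "(\<lambda>k. nrm (s k - a)) \<longlonglongrightarrow> 0" "\<And>k. nrm (s k - a) \<le> C * r ^ k / (1 - r)"
proof -
  have far: "nrm (s (k + m) - s k) \<le> C * r ^ k * (1 - r ^ m) / (1 - r)" for k m
  proof (induction m)
    case 0
    then show ?case by simp
  next
    case (Suc m)
    have "nrm (s (k + Suc m) - s k) \<le> C * r ^ (k + m) + C * r ^ k * (1 - r ^ m) / (1 - r)"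
      using nrm_diff_triangle[of "s (Suc (k + m))" "s (k + m)" "s k"] s step[of "k + m"] Suc by simp
    also have "\<dots> = C * r ^ k * (1 - r ^ Suc m) / (1 - r)"
      using r by (simp add: field_simps power_add)
    finally show ?case .
  qed
  define e where "e k = C * r ^ k / (1 - r)" for k
  have far': "nrm (s i - s k) \<le> e k" if "i \<ge> k" for i k
  proof -
    have "nrm (s i - s k) \<le> C * r ^ k * (1 - r ^ (i - k)) / (1 - r)" using far[of k "i - k"] that by simp
    also have "\<dots> \<le> e k"
      using r C by (auto simp: e_def intro!: divide_right_mono mult_left_le)
    finally show ?thesis .
  qed
  have e0: "e \<longlonglongrightarrow> 0"
    unfolding e_def using r
    by (intro tendsto_divide_zero tendsto_mult_right_zero LIMSEQ_realpow_zero) auto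
  have "cauchy_wrt nrm s"
    unfolding cauchy_wrt_def
  proof (intro allI impI)
    fix d :: real assume "d > 0"
    then obtain k where "e k < d / 2"
      using order_tendstoD(2)[OF e0, of "d / 2"] by (auto simp: eventually_sequentially)
    moreover have "nrm (s i - s j) \<le> 2 * e k" if "i \<ge> k" "j \<ge> k" for i j
      using nrm_diff_triangle[of "s i" "s k" "s j"] nrm_diff_commute[of "s k" "s j"]
        far'[OF that(1)] far'[OF that(2)] s by simp
    ultimately show "\<exists>k. \<forall>i\<ge>k. \<forall>j\<ge>k. nrm (s i - s j) < d"
      by (intro exI[of _ k] allI impI) force
  qed
  then obtain a where a: "a \<in> V" and lim: "(\<lambda>k. nrm (s k - a)) \<longlonglongrightarrow> 0" using complete s by blast
  have "nrm (s k - a) \<le> e k" for k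
  proof -
    have "(\<lambda>i. e k + nrm (s i - a)) \<longlonglongrightarrow> e k + 0" by (intro tendsto_intros lim)
    moreover have "nrm (s k - a) \<le> e k + nrm (s i - a)" if "i \<ge> k" for i
      using nrm_diff_triangle[of "s k" "s i" a] nrm_diff_commute[of "s k" "s i"] far'[OF that] s a
      by simp
    ultimately show ?thesis by (intro LIMSEQ_le_const[of _ "e k"]) auto
  qed
  with a lim that show ?thesis by (simp add: e_def)
qed

text \<open>Gliding hump: an unbounded \<open>S\<close> would give \<open>z k\<close> with \<open>\<parallel>S (z k)\<parallel> = 1\<close> and \<open>\<parallel>z k\<parallel> \<le> 4\<^sup>-\<^sup>k\<close>. At
  every step one of the signs in \<open>x \<plusminus> 3\<^sup>-\<^sup>k S (z k)\<close> makes the inner product with \<open>S (z k)\<close> at least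
  \<open>3\<^sup>-\<^sup>k\<close>, and the later steps destroy at most half of that.\<close>

lemma Hellinger_Toeplitz:
  assumes S: "linear_op S" and sym: "symmetric_op S"
  obtains K where "bounded_op K S"
proof (rule ccontr)
  assume "\<not> thesis"
  with that have unb: "\<exists>x\<in>V. K * nrm x < nrm (S x)" for K
    unfolding bounded_op_def by (meson linorder_not_le)
  have "\<exists>z\<in>V. nrm (S z) = 1 \<and> nrm z \<le> (1/4) ^ k" for k
  proof -
    obtain x where x: "x \<in> V" and lt: "4 ^ k * nrm x < nrm (S x)" using unb by blast
    have Sx: "S x \<in> V" by (rule op_mem[OF S x])
    have pos: "0 < nrm (S x)" using lt x by (meson nrm_ge_0 order_le_less_trans zero_le_mult_iff zero_le_power zero_le_numeral)
    define z where "z = of_real (1 / nrm (S x)) *\<^sub>C x"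
    have "S z = of_real (1 / nrm (S x)) *\<^sub>C S x" unfolding z_def by (rule op_scale[OF S x])
    then have "nrm (S z) = 1" using Sx pos by (auto simp: norm_divide)
    moreover have "nrm z \<le> (1/4) ^ k"
      using x pos lt by (simp add: z_def norm_divide power_divide field_simps)
    ultimately show ?thesis using x by (intro bexI[of _ z]) (auto simp: z_def)
  qed
  then obtain z where z: "\<And>k. z k \<in> V" and Sz1: "\<And>k. nrm (S (z k)) = 1"
    and zle: "\<And>k. nrm (z k) \<le> (1/4) ^ k" by metis
  have Sz: "S (z k) \<in> V" for k by (rule op_mem[OF S z])
  \<comment> \<open>The ratio 1/3 exceeds 1/4, so that (4/3)^k will diverge, and it is small enough
    for later steps: starting at \<open>Suc k\<close> they add up to (1/3)^(k+1) / (1 - 1/3),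
    exactly half of (1/3)^k.\<close>
  define t :: "nat \<Rightarrow> complex" where "t k = of_real ((1/3) ^ k)" for k
  have ct: "cmod (t k) = (1/3) ^ k" for k by (simp add: t_def norm_power norm_divide)
  define move where "move k v =
    (if (1/3) ^ k \<le> cmod (g (v + t k *\<^sub>C S (z k)) (S (z k))) then v + t k *\<^sub>C S (z k)
     else v - t k *\<^sub>C S (z k))" for k v
  have move_mem: "move k v \<in> V" if "v \<in> V" for k v using that Sz by (simp add: move_def)
  have move_step: "nrm (move k v - v) = (1/3) ^ k" if "v \<in> V" for k v
    using that Sz by (simp add: move_def Sz1 ct)
  have move_large: "(1/3) ^ k \<le> cmod (g (move k v) (S (z k)))" if v: "v \<in> V" for k v
  proof -
    define a where "a = g v (S (z k))"
    have 1: "g (t k *\<^sub>C S (z k)) (S (z k)) = t k" using Sz by (simp add: self_eq Sz1)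
    \<comment> \<open>The two candidate values \<open>a + t k\<close> and \<open>a - t k\<close> lie
      2 |t k| apart, so at least one of them has modulus at least |t k|.\<close>
    have "2 * t k = (a + t k) - (a - t k)" by simp
    then have "cmod (2 * t k) \<le> cmod (a + t k) + cmod (a - t k)" by (metis norm_triangle_ineq4)
    then have "2 * (1/3) ^ k \<le> cmod (a + t k) + cmod (a - t k)" by (simp add: norm_mult ct)
    moreover have "g (v + t k *\<^sub>C S (z k)) (S (z k)) = a + t k"
      using v Sz 1 by (simp only: add_left mem_scale a_def)
    moreover have "g (v - t k *\<^sub>C S (z k)) (S (z k)) = a - t k"
      using v Sz 1 by (simp only: diff_left mem_scale a_def)
    ultimately show ?thesis by (auto simp: move_def)
  qed
  define x where "x = rec_nat 0 move"
  have x0: "x 0 = 0" and xS: "x (Suc k) = move k (x k)" for k by (simp_all add: x_def)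
  have x: "x k \<in> V" for k by (induction k) (simp_all add: x0 xS move_mem)
  obtain a where a: "a \<in> V" and xa: "\<And>k. nrm (x k - a) \<le> 1 * (1/3) ^ k / (1 - 1/3)"
  proof (rule geometric_limit[of x "1/3" 1, OF x])
    show "nrm (x (Suc k) - x k) \<le> 1 * (1/3) ^ k" for k using move_step[OF x] by (simp add: xS)
  qed auto
  \<comment> \<open>The hump created by move \<open>k\<close> is visible from
    \<open>x (Suc k)\<close> on, and half of it survives in the limit: |g a (S (z k))| is at least
    (1/3)^k / 2. Symmetry shifts S onto \<open>a\<close>, where smallness of \<open>z k\<close>
    gives the upper bound \<open>nrm (S a)\<close> times (1/4)^k.\<close>
  have "(4/3) ^ k \<le> 2 * nrm (S a)" for k
  proof -
    define w where "w = S (z k)"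
    have w: "w \<in> V" "nrm w = 1" using Sz Sz1 by (simp_all add: w_def)
    have "(1/3) ^ k \<le> cmod (g (x (Suc k)) w)" using move_large[OF x] by (simp add: xS w_def)
    also have "g (x (Suc k)) w = g (x (Suc k) - a) w + g a w" using x a w by simp
    also have "cmod \<dots> \<le> cmod (g (x (Suc k) - a) w) + cmod (g a w)" by (rule norm_triangle_ineq)
    also have "cmod (g (x (Suc k) - a) w) \<le> nrm (x (Suc k) - a)"
      using Cauchy_Schwarz[of "x (Suc k) - a" w] x a w by simp
    also have "\<dots> \<le> (1/3) ^ k / 2" using xa[of "Suc k"] by simp
    also have "cmod (g a w) = cmod (g (S a) (z k))"
      using sym a z by (simp add: symmetric_op_def w_def)
    also have "\<dots> \<le> nrm (S a) * nrm (z k)" by (rule Cauchy_Schwarz[OF op_mem[OF S a] z])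
    also have "\<dots> \<le> nrm (S a) * (1/4) ^ k" using zle op_mem[OF S a] by (intro mult_left_mono) auto
    finally have "(1/3) ^ k \<le> 2 * nrm (S a) * (1/4) ^ k" by simp
    then show ?thesis by (simp add: power_divide field_simps)
  qed
  moreover obtain k where "2 * nrm (S a) < (4/3) ^ k" using real_arch_pow[of "4/3"] by auto
  ultimately show False by (meson not_le)
qed

text \<open>\<open>1 - Y\<close> is the positive square root of \<open>1 - E\<close>; \<open>Y\<close> is the limit of the iteration
  \<open>Y \<mapsto> (E + Y\<^sup>2) / 2\<close>, whose iterates are polynomials in \<open>E\<close> and hence commute. The bound
  \<open>r = 1 - sqrt (1 - q)\<close> is the fixed point of the scalar iteration \<open>r \<mapsto> (q + r\<^sup>2) / 2\<close>.\<close>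

lemma one_minus_sqrt_exists:
  assumes E: "linear_op E" "symmetric_op E" "bounded_op q E" and q: "0 \<le> q" "q < 1"
  obtains Y r where "r < 1" "linear_op Y" "symmetric_op Y" "bounded_op r Y"
    "\<And>x. x \<in> V \<Longrightarrow> 2 *\<^sub>C Y x = E x + Y (Y x)"
    "\<And>A K x. linear_op A \<Longrightarrow> bounded_op K A \<Longrightarrow> \<forall>x\<in>V. A (E x) = E (A x) \<Longrightarrow> x \<in> V \<Longrightarrow> A (Y x) = Y (A x)"
proof -
  define r where "r = 1 - sqrt (1 - q)"
  have r: "0 \<le> r" "r < 1" using q by (simp_all add: r_def)
  have rr: "(q + r * r) / 2 = r"
  proof -
    have "(1 - r) * (1 - r) = 1 - q" using q by (simp add: r_def)
    then show ?thesis by (simp add: algebra_simps)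
  qed
  let ?Y = "one_minus_sqrt_iter E"
  have lin: "linear_op (?Y n)" for n
  proof (induction n)
    case 0
    show ?case by (rule linear_opI) simp_all
  next
    case (Suc n)
    then show ?case using E(1)
      by (intro linear_opI)
        (simp_all add: op_mem op_add op_scale complex_vector.scale_right_distrib mult.commute add_ac)
  qed
  have sym: "symmetric_op (?Y n)" for n
  proof (induction n)
    case 0
    show ?case by (simp add: symmetric_op_def)
  next
    case (Suc n)
    have "g (?Y (Suc n) x) y = g x (?Y (Suc n) y)" if xy: "x \<in> V" "y \<in> V" for x y
    proof -
      have "g (?Y n (?Y n x)) y = g x (?Y n (?Y n y))"
        using Suc xy op_mem[OF lin] by (simp add: symmetric_op_def)
      moreover have "g (E x) y = g x (E y)" using E(2) xy by (simp add: symmetric_op_def)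
      ultimately show ?thesis using xy by (simp add: op_mem[OF lin] op_mem[OF E(1)])
    qed
    then show ?case unfolding symmetric_op_def by blast
  qed
  have bd: "bounded_op r (?Y n)" for n
  proof (induction n)
    case 0
    show ?case using r by (simp add: bounded_op_def)
  next
    case (Suc n)
    have "nrm (?Y (Suc n) x) \<le> r * nrm x" if x: "x \<in> V" for x
    proof -
      have "nrm (?Y (Suc n) x) = nrm (E x + ?Y n (?Y n x)) / 2"
        using x by (simp add: op_mem[OF lin] op_mem[OF E(1)] norm_divide)
      also have "\<dots> \<le> (nrm (E x) + nrm (?Y n (?Y n x))) / 2"
        using nrm_triangle x by (simp add: op_mem[OF lin] op_mem[OF E(1)])
      also have "\<dots> \<le> (q * nrm x + r * (r * nrm x)) / 2"
        using bounded_op_compose[OF lin Suc Suc r(1) x] E(3) x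
        by (intro divide_right_mono add_mono) (auto simp: bounded_op_def)
      also have "\<dots> = (q + r * r) / 2 * nrm x" by (simp add: algebra_simps)
      also have "\<dots> = r * nrm x" by (simp only: rr)
      finally show ?thesis .
    qed
    then show ?case by (simp add: bounded_op_def del: one_minus_sqrt_iter.simps)
  qed
  have comm: "A (?Y n x) = ?Y n (A x)"
    if A: "linear_op A" and AE: "\<forall>x\<in>V. A (E x) = E (A x)" and "x \<in> V" for A n x
    using \<open>x \<in> V\<close>
  proof (induction n arbitrary: x)
    case 0
    show ?case by (simp add: op_zero[OF A])
  next
    case (Suc n)
    then show ?case
      by (simp add: op_mem[OF lin] op_mem[OF E(1)] op_scale[OF A] op_add[OF A] op_mem[OF A] AE)
  qed
  \<comment> \<open>\<open>comm\<close> is used twice: with \<open>A = E\<close> it shows that every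
    iterate commutes with E, and so every iterate is itself an admissible \<open>A\<close>.\<close>
  have commY: "?Y m (?Y n x) = ?Y n (?Y m x)" if "x \<in> V" for m n x
    by (rule comm[OF lin _ that]) (use comm[OF E(1)] in metis)
  \<comment> \<open>For commuting iterates a and b one has a^2 - b^2 = (a + b)(a - b), and (a + b)/2
    has norm at most r. Hence each step shrinks the difference by the factor r.\<close>
  have step: "nrm (?Y (Suc n) x - ?Y n x) \<le> r ^ n * nrm x" if "x \<in> V" for n x
    using that
  proof (induction n arbitrary: x)
    case 0
    have "nrm (E x) \<le> q * nrm x" using E(3) 0 by (simp add: bounded_op_def)
    also have "\<dots> \<le> 2 * nrm x" using q 0 by (intro mult_right_mono) auto
    finally show ?case using 0 by (simp add: norm_divide op_mem[OF E(1)])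
  next
    case (Suc n)
    let ?a = "?Y (Suc n)" and ?b = "?Y n"
    define w where "w = ?a x - ?b x"
    have mem: "?a y \<in> V" "?b y \<in> V" if "y \<in> V" for y using that op_mem[OF lin] by blast+
    have w: "w \<in> V" using mem Suc.prems by (simp add: w_def del: one_minus_sqrt_iter.simps)
    have "?Y (Suc (Suc n)) x - ?Y (Suc n) x = (1/2) *\<^sub>C (E x + ?a (?a x)) - (1/2) *\<^sub>C (E x + ?b (?b x))"
      by (simp only: one_minus_sqrt_iter.simps)
    also have "\<dots> = (1/2) *\<^sub>C (?a (?a x) - ?b (?b x))"
      by (simp only: complex_vector.scale_right_diff_distrib[symmetric] add_diff_cancel_left)
    also have "?a (?a x) - ?b (?b x) = ?a w + ?b w"
      using commY[OF Suc.prems, of "Suc n" n] mem Suc.prems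
      by (simp add: w_def op_diff[OF lin] del: one_minus_sqrt_iter.simps)
    finally have "nrm (?Y (Suc (Suc n)) x - ?Y (Suc n) x) = nrm (?a w + ?b w) / 2"
      using mem[OF w] by (simp add: norm_divide del: one_minus_sqrt_iter.simps)
    also have "\<dots> \<le> (nrm (?a w) + nrm (?b w)) / 2"
      using nrm_triangle mem[OF w] by (simp del: one_minus_sqrt_iter.simps)
    also have "\<dots> \<le> (r * nrm w + r * nrm w) / 2"
      using bd w unfolding bounded_op_def by (intro divide_right_mono add_mono) (blast, blast, simp)
    also have "\<dots> = r * nrm w" by simp
    also have "\<dots> \<le> r * (r ^ n * nrm x)"
      using Suc.IH[OF Suc.prems] r unfolding w_def by (intro mult_left_mono) auto
    finally show ?case by simp
  qed
  have "\<exists>a\<in>V. (\<lambda>n. nrm (?Y n x - a)) \<longlonglongrightarrow> 0" if x: "x \<in> V" for x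
  proof -
    have mem: "\<And>n. ?Y n x \<in> V" using op_mem[OF lin x] by blast
    have st: "\<And>n. nrm (?Y (Suc n) x - ?Y n x) \<le> nrm x * r ^ n"
      using step[OF x] by (simp add: mult.commute del: one_minus_sqrt_iter.simps)
    show ?thesis by (rule geometric_limit[of "\<lambda>n. ?Y n x" r "nrm x", OF mem r _ st]) (use x in auto)
  qed
  then obtain Y where Y: "\<And>x. x \<in> V \<Longrightarrow> Y x \<in> V"
    and lim: "\<And>x. x \<in> V \<Longrightarrow> (\<lambda>n. nrm (?Y n x - Y x)) \<longlonglongrightarrow> 0" by metis
  have limI: "Y x = a" if "x \<in> V" "a \<in> V" "(\<lambda>n. nrm (?Y n x - a)) \<longlonglongrightarrow> 0" for x a
    by (rule limit_unique[OF op_mem[OF lin that(1)] Y[OF that(1)] that(2) lim[OF that(1)] that(3)])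
  have linY: "linear_op Y"
  proof (rule linear_opI)
    show "Y x \<in> V" if "x \<in> V" for x by (rule Y[OF that])
    show "Y (x + y) = Y x + Y y" if xy: "x \<in> V" "y \<in> V" for x y
    proof (rule limI)
      have *: "(\<lambda>n. nrm (?Y n x - Y x) + nrm (?Y n y - Y y)) \<longlonglongrightarrow> 0"
        using tendsto_add[OF lim[OF xy(1)] lim[OF xy(2)]] by simp
      have "norm (nrm (?Y n (x + y) - (Y x + Y y))) \<le> nrm (?Y n x - Y x) + nrm (?Y n y - Y y)" for n
        using nrm_triangle[of "?Y n x - Y x" "?Y n y - Y y"] xy Y op_mem[OF lin]
        by (simp add: op_add[OF lin] algebra_simps)
      then show "(\<lambda>n. nrm (?Y n (x + y) - (Y x + Y y))) \<longlonglongrightarrow> 0"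
        by (intro Lim_null_comparison[OF _ *] always_eventually) blast
    qed (use xy Y in auto)
    show "Y (a *\<^sub>C x) = a *\<^sub>C Y x" if x: "x \<in> V" for a x
    proof (rule limI)
      have "nrm (?Y n (a *\<^sub>C x) - a *\<^sub>C Y x) = cmod a * nrm (?Y n x - Y x)" for n
        using x Y op_mem[OF lin]
        by (simp add: op_scale[OF lin] complex_vector.scale_right_diff_distrib[symmetric])
      then show "(\<lambda>n. nrm (?Y n (a *\<^sub>C x) - a *\<^sub>C Y x)) \<longlonglongrightarrow> 0"
        using tendsto_mult_right_zero[OF lim[OF x]] by simp
    qed (use x Y in auto)
  qed
  have symY: "symmetric_op Y"
    unfolding symmetric_op_def
  proof (intro ballI)
    fix x y assume xy: "x \<in> V" "y \<in> V"
    have 1: "(\<lambda>n. g (?Y n x) y) \<longlonglongrightarrow> g (Y x) y"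
      by (rule tendsto_inner[OF op_mem[OF lin xy(1)] Y[OF xy(1)] xy(2) lim[OF xy(1)]])
    have "(\<lambda>n. cnj (g (?Y n y) x)) \<longlonglongrightarrow> cnj (g (Y y) x)"
      by (intro tendsto_cnj tendsto_inner[OF op_mem[OF lin xy(2)] Y[OF xy(2)] xy(1) lim[OF xy(2)]])
    then have 2: "(\<lambda>n. g (?Y n x) y) \<longlonglongrightarrow> g x (Y y)"
      using xy Y op_mem[OF lin] sym by (simp add: commute symmetric_op_def)
    show "g (Y x) y = g x (Y y)" by (rule LIMSEQ_unique[OF 1 2])
  qed
  have bdY: "bounded_op r Y"
    unfolding bounded_op_def
  proof
    fix x assume x: "x \<in> V"
    show "nrm (Y x) \<le> r * nrm x"
      by (rule LIMSEQ_le_const2[OF tendsto_nrm[OF op_mem[OF lin x] Y[OF x] lim[OF x]]])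
        (use bd x in \<open>auto simp: bounded_op_def\<close>)
  qed
  \<comment> \<open>The iteration can be passed to the limit although it is quadratic:
    \<open>?Y n (?Y n x) - Y (Y x)\<close> splits into \<open>?Y n (?Y n x - Y x)\<close>,
    controlled by the uniform bound r, and \<open>?Y n (Y x) - Y (Y x)\<close>, controlled by
    convergence at the point \<open>Y x\<close>.\<close>
  have fix_eq: "2 *\<^sub>C Y x = E x + Y (Y x)" if x: "x \<in> V" for x
  proof -
    have Ex: "E x \<in> V" by (rule op_mem[OF E(1) x])
    have "(\<lambda>n. nrm (?Y (Suc n) x - Y x)) \<longlonglongrightarrow> 0" by (rule LIMSEQ_Suc[OF lim[OF x]])
    moreover have "(\<lambda>n. nrm (?Y (Suc n) x - (1/2) *\<^sub>C (E x + Y (Y x)))) \<longlonglongrightarrow> 0"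
    proof -
      have *: "(\<lambda>n. r * nrm (?Y n x - Y x) + nrm (?Y n (Y x) - Y (Y x))) \<longlonglongrightarrow> 0"
        using tendsto_add[OF tendsto_mult_right_zero[OF lim[OF x]] lim[OF Y[OF x]]] by simp
      have "norm (nrm (?Y (Suc n) x - (1/2) *\<^sub>C (E x + Y (Y x))))
          \<le> r * nrm (?Y n x - Y x) + nrm (?Y n (Y x) - Y (Y x))" for n
      proof -
        have m: "?Y n x \<in> V" "?Y n (?Y n x) \<in> V" "Y x \<in> V" "Y (Y x) \<in> V" "?Y n (Y x) \<in> V"
          using x Y op_mem[OF lin] by blast+
        have "?Y (Suc n) x - (1/2) *\<^sub>C (E x + Y (Y x)) = (1/2) *\<^sub>C (?Y n (?Y n x) - Y (Y x))"
          by (simp add: complex_vector.scale_right_distrib complex_vector.scale_right_diff_distrib)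
        then have "nrm (?Y (Suc n) x - (1/2) *\<^sub>C (E x + Y (Y x))) = nrm (?Y n (?Y n x) - Y (Y x)) / 2"
          using m by (simp add: norm_divide)
        also have "\<dots> \<le> nrm (?Y n (?Y n x) - Y (Y x))" using m by simp
        also have "\<dots> \<le> nrm (?Y n (?Y n x) - ?Y n (Y x)) + nrm (?Y n (Y x) - Y (Y x))"
          using m by (intro nrm_diff_triangle)
        also have "nrm (?Y n (?Y n x) - ?Y n (Y x)) \<le> r * nrm (?Y n x - Y x)"
          using bd[of n] m op_diff[OF lin, of "?Y n x" "Y x" n] unfolding bounded_op_def
          by (metis mem_diff)
        finally show ?thesis using m Ex x op_mem[OF lin] by (simp del: one_minus_sqrt_iter.simps)
      qed
      then show ?thesis by (intro Lim_null_comparison[OF _ *] always_eventually) blast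
    qed
    ultimately have "Y x = (1/2) *\<^sub>C (E x + Y (Y x))"
      using x Y Ex by (intro limit_unique[of "\<lambda>n. ?Y (Suc n) x"] op_mem[OF lin]) auto
    then have "2 *\<^sub>C Y x = 2 *\<^sub>C (1/2) *\<^sub>C (E x + Y (Y x))" by simp
    then show ?thesis by simp
  qed
  \<comment> \<open>The bound on \<open>A\<close> is what allows it to be exchanged with the
    pointwise limit.\<close>
  have commA: "A (Y x) = Y (A x)"
    if A: "linear_op A" "bounded_op K A" and AE: "\<forall>x\<in>V. A (E x) = E (A x)" and x: "x \<in> V" for A K x
  proof -
    have "(\<lambda>n. nrm (A (?Y n x) - A (Y x))) \<longlonglongrightarrow> 0"
      by (rule op_limit[OF A op_mem[OF lin x] Y[OF x] lim[OF x]])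
    then have "(\<lambda>n. nrm (?Y n (A x) - A (Y x))) \<longlonglongrightarrow> 0" by (simp add: comm[OF A(1) AE x])
    then show ?thesis
      using limI[of "A x" "A (Y x)"] op_mem[OF A(1)] x Y by simp
  qed
  show ?thesis by (rule that[OF r(2) linY symY bdY fix_eq commA])
qed

text \<open>The square root is taken of T^2 = 1 - E. The two bounds on T keep the norm of E below 1,
  so Y has norm at most r < 1 and B = 1 - Y is bounded below by 1 - r. T commutes with E, hence with
  Y and B.\<close>

lemma modulus_exists:
  assumes T: "linear_op T" "symmetric_op T" "bounded_op 1 T"
    and c: "0 < c" "c \<le> 1" and lower: "\<And>x. x \<in> V \<Longrightarrow> c * nrm x \<le> nrm (T x)"
  obtains B d where "linear_op B" "symmetric_op B" "bounded_op 2 B" "0 < d"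
    "\<And>x. x \<in> V \<Longrightarrow> d * (nrm x)\<^sup>2 \<le> Re (g (B x) x)"
    "\<And>x. x \<in> V \<Longrightarrow> B (B x) = T (T x)" "\<And>x. x \<in> V \<Longrightarrow> T (B x) = B (T x)"
proof -
  define E where "E x = x - T (T x)" for x
  \<comment> \<open>By symmetry \<open>g x (T (T x))\<close> is the square of
    \<open>nrm (T x)\<close>. Expanding \<open>nrm (E x)\<close> squared therefore leaves at most (1
    - c^2) times the square of \<open>nrm x\<close>, and q is the root of that factor.\<close>
  define q where "q = sqrt (1 - c\<^sup>2)"
  have c2: "c\<^sup>2 \<le> 1" "0 < c\<^sup>2" using c by (simp_all add: power_le_one)
  have q: "0 \<le> q" "q < 1" using c2 by (simp_all add: q_def)
  have linE: "linear_op E"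
    unfolding E_def by (rule linear_op_diff[OF linear_op_id linear_op_compose[OF T(1) T(1)]])
  have Tm: "T x \<in> V" if "x \<in> V" for x by (rule op_mem[OF T(1) that])
  have symT: "g (T x) y = g x (T y)" if "x \<in> V" "y \<in> V" for x y
    using T(2) that by (simp add: symmetric_op_def)
  have symE: "symmetric_op E"
    unfolding symmetric_op_def E_def by (simp add: Tm symT)
  have bdE: "bounded_op q E"
    unfolding bounded_op_def
  proof
    fix x assume x: "x \<in> V"
    have "nrm (T (T x)) \<le> nrm (T x)" using T(3) Tm[OF x] by (simp add: bounded_op_def)
    then have TT: "(nrm (T (T x)))\<^sup>2 \<le> (nrm (T x))\<^sup>2" using Tm x by (intro power_mono) auto
    have "c\<^sup>2 * (nrm x)\<^sup>2 \<le> (nrm (T x))\<^sup>2"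
      using power_mono[OF lower[OF x], of 2] c x by (simp add: power_mult_distrib)
    moreover have "(nrm (E x))\<^sup>2 = (nrm x)\<^sup>2 - 2 * (nrm (T x))\<^sup>2 + (nrm (T (T x)))\<^sup>2"
      using x Tm symT[OF x Tm[OF x], symmetric] by (simp add: E_def nrm_sq_diff nrm_sq[of "T x"])
    ultimately have "(nrm (E x))\<^sup>2 \<le> (1 - c\<^sup>2) * (nrm x)\<^sup>2"
      using TT by (simp add: algebra_simps)
    also have "\<dots> = (q * nrm x)\<^sup>2" using c2 by (simp add: q_def power_mult_distrib)
    finally show "nrm (E x) \<le> q * nrm x"
      using q x by (intro power2_le_imp_le[of "nrm (E x)"]) auto
  qed
  show ?thesis
  proof (rule one_minus_sqrt_exists[OF linE symE bdE q])
    fix Y r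
    assume r: "r < (1::real)" and Y: "linear_op Y" "symmetric_op Y" "bounded_op r Y"
      and fix_eq: "\<And>x. x \<in> V \<Longrightarrow> 2 *\<^sub>C Y x = E x + Y (Y x)"
      and comm: "\<And>A K x. linear_op A \<Longrightarrow> bounded_op K A \<Longrightarrow> \<forall>x\<in>V. A (E x) = E (A x) \<Longrightarrow> x \<in> V
        \<Longrightarrow> A (Y x) = Y (A x)"
    have Ym: "Y x \<in> V" if "x \<in> V" for x by (rule op_mem[OF Y(1) that])
    have Yle: "nrm (Y x) \<le> r * nrm x" if "x \<in> V" for x using Y(3) that by (simp add: bounded_op_def)
    define B where "B x = x - Y x" for x
    show thesis
    proof (rule that[of B "1 - r"])
      show "linear_op B" unfolding B_def by (intro linear_op_diff linear_op_id Y(1))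
      show "symmetric_op B"
        using Y(2) by (simp add: symmetric_op_def B_def Ym)
      show "bounded_op 2 B"
        unfolding bounded_op_def
      proof
        fix x assume x: "x \<in> V"
        have "nrm (B x) \<le> nrm x + nrm (Y x)" using nrm_diff_le x Ym by (simp add: B_def)
        also have "nrm (Y x) \<le> 1 * nrm x"
          using Yle[OF x] mult_right_mono[of r 1 "nrm x"] r x by simp
        finally show "nrm (B x) \<le> 2 * nrm x" by simp
      qed
      show "0 < 1 - r" using r by simp
      show "(1 - r) * (nrm x)\<^sup>2 \<le> Re (g (B x) x)" if x: "x \<in> V" for x
      proof -
        have "Re (g (Y x) x) \<le> nrm (Y x) * nrm x"
          using Cauchy_Schwarz[OF Ym[OF x] x] complex_Re_le_cmod[of "g (Y x) x"] by linarith
        also have "\<dots> \<le> r * nrm x * nrm x" using Yle[OF x] x by (intro mult_right_mono) auto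
        finally show ?thesis
          using x Ym by (simp add: B_def nrm_sq[symmetric] power2_eq_square algebra_simps)
      qed
      show "B (B x) = T (T x)" if x: "x \<in> V" for x
      proof -
        have "B (B x) = x - 2 *\<^sub>C Y x + Y (Y x)"
          using x Ym complex_vector.scale_left_distrib[of 1 1 "Y x"]
          by (simp add: B_def op_diff[OF Y(1)] algebra_simps)
        also have "\<dots> = T (T x)" by (simp add: fix_eq[OF x]) (simp add: E_def)
        finally show ?thesis .
      qed
      show "T (B x) = B (T x)" if x: "x \<in> V" for x
      proof -
        have "\<forall>x\<in>V. T (E x) = E (T x)" by (simp add: E_def op_diff[OF T(1)] Tm)
        then have "T (Y x) = Y (T x)" by (rule comm[OF T(1,3) _ x])
        then show ?thesis using x Ym by (simp add: B_def op_diff[OF T(1)])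
      qed
    qed
  qed
qed

section \<open>Splitting a symmetric operator by its modulus\<close>

lemma equalizer_subspace:
  assumes A: "linear_op A" and C: "linear_op C"
  shows "complex_vector.subspace {x \<in> V. A x = C x}"
  using assms by (intro complex_vector.subspaceI) (auto simp: op_zero op_add op_scale)

text \<open>\<open>A a\<close> and \<open>C a\<close> are limits of the same sequence
  \<open>A (s k) = C (s k)\<close>, hence equal. With \<open>C\<close> being B or -B this is the
  completeness of the two kernels.\<close>

lemma equalizer_complete:
  assumes A: "linear_op A" "bounded_op K A" and C: "linear_op C" "bounded_op M C"
    and s: "\<And>k. s k \<in> {x \<in> V. A x = C x}" and "cauchy_wrt nrm s"
  shows "\<exists>a\<in>{x \<in> V. A x = C x}. (\<lambda>k. nrm (s k - a)) \<longlonglongrightarrow> 0"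
proof -
  have sV: "\<And>k. s k \<in> V" and AC: "\<And>k. A (s k) = C (s k)" using s by auto
  obtain a where a: "a \<in> V" and lim: "(\<lambda>k. nrm (s k - a)) \<longlonglongrightarrow> 0"
    using complete[OF sV assms(6)] by blast
  have "(\<lambda>k. nrm (A (s k) - C a)) \<longlonglongrightarrow> 0"
    using op_limit[OF C sV a lim] by (simp add: AC)
  then have "A a = C a"
    using limit_unique[OF op_mem[OF A(1) sV] op_mem[OF A(1) a] op_mem[OF C(1) a] op_limit[OF A sV a lim]]
    by simp
  with a lim show ?thesis by blast
qed

text \<open>With \<open>B = |T|\<close> the summands are the ranges of \<open>(1 \<plusminus> T B\<^sup>-\<^sup>1) / 2\<close>.\<close>

lemma fundamental_decomposition_of_operator:
  assumes T: "linear_op T" "symmetric_op T" "bounded_op 1 T" and surj: "\<And>y. y \<in> V \<Longrightarrow> \<exists>x\<in>V. T x = y"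
    and c: "0 < c" "c \<le> 1" and lower: "\<And>x. x \<in> V \<Longrightarrow> c * nrm x \<le> nrm (T x)"
    and f: "sesquilinear_on V f" "symmetric_on V f"
    and b: "0 < b" and fT: "\<And>x y. x \<in> V \<Longrightarrow> y \<in> V \<Longrightarrow> f x y = of_real b * g (T x) y"
  obtains Dp Dm d where "fundamental_decomposition V f Dp Dm" "0 < d" "Dp \<subseteq> V" "Dm \<subseteq> V"
    "\<And>x. x \<in> Dp \<Longrightarrow> d * (nrm x)\<^sup>2 \<le> Re (f x x)" "\<And>x. x \<in> Dm \<Longrightarrow> d * (nrm x)\<^sup>2 \<le> - Re (f x x)"
proof (rule modulus_exists[OF T c lower])
  fix B d
  assume B: "linear_op B" "symmetric_op B" "bounded_op 2 B" and d: "0 < (d::real)"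
    and pos: "\<And>x. x \<in> V \<Longrightarrow> d * (nrm x)\<^sup>2 \<le> Re (g (B x) x)"
    and BB: "\<And>x. x \<in> V \<Longrightarrow> B (B x) = T (T x)" and TB: "\<And>x. x \<in> V \<Longrightarrow> T (B x) = B (T x)"
  have Bm: "B x \<in> V" and Tm: "T x \<in> V" if "x \<in> V" for x
    using op_mem[OF B(1) that] op_mem[OF T(1) that] .
  have B0: "x = 0" if "x \<in> V" "B x = 0" for x
    using pos[OF that(1)] d that nrm_pos[OF that(1)] by (auto simp: mult_le_0_iff)
  have sub: "sesquilinear_on W f" "symmetric_on W f" if "W \<subseteq> V" for W
    using f that unfolding sesquilinear_on_def symmetric_on_def by (meson subsetD)+
  define Dp where "Dp = {x \<in> V. T x = B x}"
  define Dm where "Dm = {x \<in> V. T x = - B x}"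
  have W: "complex_vector.subspace Dp" "complex_vector.subspace Dm"
    unfolding Dp_def Dm_def by (intro equalizer_subspace T B linear_op_neg)+
  have WV: "Dp \<subseteq> V" "Dm \<subseteq> V" by (auto simp: Dp_def Dm_def)
  have nB: "bounded_op 2 (\<lambda>x. - B x)" using B(3) Bm by (simp add: bounded_op_def)
  have lo_p: "b * d * (nrm x)\<^sup>2 \<le> Re (f x x)" if "x \<in> Dp" for x
    using that pos[of x] b by (simp add: Dp_def fT mult.assoc)
  have lo_m: "b * d * (nrm x)\<^sup>2 \<le> - Re (f x x)" if "x \<in> Dm" for x
    using that pos[of x] b by (simp add: Dm_def fT mult.assoc Bm)
  have up: "\<bar>Re (f x x)\<bar> \<le> b * (nrm x)\<^sup>2" if x: "x \<in> V" for x
  proof -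
    have "\<bar>Re (g (T x) x)\<bar> \<le> nrm (T x) * nrm x"
      using Cauchy_Schwarz[OF Tm[OF x] x] abs_Re_le_cmod order_trans by blast
    also have "\<dots> \<le> nrm x * nrm x" using T(3) x by (intro mult_right_mono) (auto simp: bounded_op_def)
    finally show ?thesis using x b by (simp add: fT abs_mult power2_eq_square)
  qed
  have hp: "hilbert_on Dp f"
  proof (rule hilbert_on_closed_subspace[OF W(1) WV(1) sub[OF WV(1)]])
    show "0 < b * d" using b d by simp
    show "Re (f x x) \<le> b * (nrm x)\<^sup>2" if "x \<in> Dp" for x
      using up[of x] that WV(1) by (auto simp: abs_le_iff)
    show "\<exists>a\<in>Dp. (\<lambda>k. nrm (s k - a)) \<longlonglongrightarrow> 0" if "\<And>k. s k \<in> Dp" "cauchy_wrt nrm s" for s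
      using equalizer_complete[OF T(1,3) B(1,3) that[unfolded Dp_def]] unfolding Dp_def .
  qed (rule lo_p)
  have hm: "hilbert_on Dm (\<lambda>x y. - f x y)"
  proof (rule hilbert_on_closed_subspace[OF W(2) WV(2)])
    show "sesquilinear_on Dm (\<lambda>x y. - f x y)"
      using sub(1)[OF WV(2)] unfolding sesquilinear_on_def by simp
    show "symmetric_on Dm (\<lambda>x y. - f x y)"
      using sub(2)[OF WV(2)] unfolding symmetric_on_def by (metis complex_cnj_minus)
    show "0 < b * d" using b d by simp
    show "b * d * (nrm x)\<^sup>2 \<le> Re (- f x x)" if "x \<in> Dm" for x using lo_m[OF that] by simp
    show "Re (- f x x) \<le> b * (nrm x)\<^sup>2" if "x \<in> Dm" for x
      using up[of x] that WV(2) by (auto simp: abs_le_iff)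
    show "\<exists>a\<in>Dm. (\<lambda>k. nrm (s k - a)) \<longlonglongrightarrow> 0" if "\<And>k. s k \<in> Dm" "cauchy_wrt nrm s" for s
      using equalizer_complete[OF T(1,3) linear_op_neg[OF B(1)] nB that[unfolded Dm_def]]
      unfolding Dm_def .
  qed
  have sum: "V = {x + y |x y. x \<in> Dp \<and> y \<in> Dm}"
  proof (intro equalityI subsetI)
    fix x assume x: "x \<in> V"
    obtain y where y: "y \<in> V" "T y = x" using surj[OF x] by blast
    obtain z where z: "z \<in> V" "T z = y" using surj[OF y(1)] by blast
    \<comment> \<open>B^2 z = T^2 z = x, so \<open>w\<close> is half of the preimage of
      \<open>x\<close> under B. Surjectivity of T, applied twice, thus supplies the inverse of B,
      and \<open>B w + T w\<close>, \<open>B w - T w\<close> are the two components of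
      \<open>x\<close>.\<close>
    define w where "w = (1/2) *\<^sub>C B z"
    have w: "w \<in> V" using z Bm by (simp add: w_def)
    have "B w = (1/2) *\<^sub>C x" using z y Bm by (simp add: w_def op_scale[OF B(1)] BB)
    then have "x = B w + B w"
      using complex_vector.scale_left_distrib[of "1/2" "1/2" x] by simp
    then have "x = (B w + T w) + (B w - T w)" by simp
    moreover have "B w + T w \<in> Dp"
      using w Bm Tm by (simp add: Dp_def op_add[OF T(1)] op_add[OF B(1)] BB TB add.commute)
    moreover have "B w - T w \<in> Dm"
      using w Bm Tm by (simp add: Dm_def op_diff[OF T(1)] op_diff[OF B(1)] BB TB)
    ultimately show "x \<in> {x + y |x y. x \<in> Dp \<and> y \<in> Dm}" by blast
  qed (use WV in auto)
  have int: "Dp \<inter> Dm = {0}"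
  proof -
    have "x = 0" if "x \<in> Dp" "x \<in> Dm" for x
    proof -
      have x: "x \<in> V" and "B x = - B x" using that by (auto simp: Dp_def Dm_def)
      then have "B x + B x = 0" by (metis add.right_inverse)
      then have "2 *\<^sub>C B x = 0" using complex_vector.scale_left_distrib[of 1 1 "B x"] by simp
      then show ?thesis using B0[OF x] by simp
    qed
    moreover have "0 \<in> Dp" "0 \<in> Dm" using W complex_vector.subspace_0 by blast+
    ultimately show ?thesis by blast
  qed
  \<comment> \<open>Moving T from \<open>x\<close> to \<open>y\<close> replaces it by -B on
    \<open>Dm\<close>; moving B back and using T = B on \<open>Dp\<close> shows that
    \<open>g (T x) y\<close> equals its own negative.\<close>
  have orth: "f x y = 0" if xy: "x \<in> Dp" "y \<in> Dm" for x y
  proof -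
    have V: "x \<in> V" "y \<in> V" using xy WV by blast+
    have "g (T x) y = g x (T y)" using T(2) V by (simp add: symmetric_op_def)
    also have "\<dots> = - g x (B y)" using xy V Bm by (simp add: Dm_def)
    also have "\<dots> = - g (T x) y" using xy V B(2) by (simp add: Dp_def symmetric_op_def)
    finally show ?thesis using V by (simp add: fT)
  qed
  have "fundamental_decomposition V f Dp Dm"
    unfolding fundamental_decomposition_def using hp hm sum int orth by blast
  then show thesis by (rule that[OF _ _ WV lo_p lo_m]) (use b d in simp_all)
qed

end

section \<open>The inner product of H and bounded embeddings\<close>

lemma sesquilinear_on_cinner: "sesquilinear_on V (cinner :: 'h::complex_hilbert \<Rightarrow> 'h \<Rightarrow> complex)"
proof -
  have "cinner x (y + z) = cinner x y + cinner x z" for x y z :: 'h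
    using cinner_add_left[of y z x] by (metis cinner_commute complex_cnj_add)
  moreover have "cinner x (a *\<^sub>C y) = cnj a * cinner x y" for a and x y :: 'h
    using cinner_scaleC_left[of a y x] by (metis cinner_commute complex_cnj_mult)
  ultimately show ?thesis
    by (simp add: sesquilinear_on_def cinner_add_left cinner_scaleC_left)
qed

lemma pre_hilbert_cinner: "pre_hilbert UNIV (cinner :: 'h::complex_hilbert \<Rightarrow> 'h \<Rightarrow> complex)"
proof
  have "0 < Re (cinner x x)" if "x \<noteq> 0" for x :: 'h
    using that norm_eq_sqrt_cinner[of x] by (metis zero_less_norm_iff real_sqrt_gt_0_iff)
  then show "inner_product_on UNIV (cinner :: 'h \<Rightarrow> 'h \<Rightarrow> complex)"
    using cinner_commute unfolding inner_product_on_def symmetric_on_def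
    by (auto intro: sesquilinear_on_cinner)
qed simp

lemma norm_cinner_le: "cmod (cinner x y) \<le> norm x * norm (y :: 'h::complex_hilbert)"
  using pre_hilbert.Cauchy_Schwarz[OF pre_hilbert_cinner, of x y]
  by (simp add: form_norm_def norm_eq_sqrt_cinner)

text \<open>Continuity of a linear map is boundedness; this translates the topological embedding of
  a Krein space into condition (1) of q-closedness. The map is a parameter because the type
  underlying \<open>V\<close> is only a \<open>complex_vec\<close>; it will be the identity.\<close>

lemma (in pre_hilbert) continuous_map_embedding_iff:
  fixes emb :: "'a \<Rightarrow> 'h::complex_hilbert"
  assumes add: "\<And>x y. emb (x + y) = emb x + emb y" and sc: "\<And>a x. emb (a *\<^sub>C x) = a *\<^sub>C emb x"
  shows "continuous_map (Metric_space.mtopology V (norm_dist V nrm)) euclidean emb \<longleftrightarrow>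
    (\<exists>\<alpha>>0. \<forall>x\<in>V. norm (emb x) \<le> \<alpha> * nrm x)"
proof -
  interpret M: Metric_space V "norm_dist V nrm" by (rule Metric_space_norm_dist[OF subspace norm_on])
  have emb0: "emb 0 = 0" using add[of 0 0] by simp
  have emb_diff: "emb x - emb y = emb (x - y)" for x y using add[of "x - y" y] by simp
  have nh: "norm (of_real r *\<^sub>C h) = \<bar>r\<bar> * norm h" for r and h :: 'h
    by (metis scaleR_scaleC norm_scaleR)
  have iff: "continuous_map M.mtopology euclidean emb \<longleftrightarrow>
    (\<forall>a\<in>V. \<forall>\<epsilon>>0. \<exists>\<delta>>0. \<forall>x. x \<in> V \<and> nrm (a - x) < \<delta> \<longrightarrow> norm (emb (a - x)) < \<epsilon>)"
    using M.metric_continuous_map[OF Met_TC.Metric_space_axioms, where f = emb]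
    by (simp add: norm_dist_def dist_norm emb_diff cong: conj_cong)
  show ?thesis
  proof
    assume "continuous_map M.mtopology euclidean emb"
    then obtain \<delta> where \<delta>: "\<delta> > 0" "\<And>x. x \<in> V \<Longrightarrow> nrm (0 - x) < \<delta> \<Longrightarrow> norm (emb (0 - x)) < 1"
      unfolding iff by (meson mem_0 zero_less_one)
    have "norm (emb x) \<le> (2 / \<delta>) * nrm x" if x: "x \<in> V" for x
    proof (cases "x = 0")
      case True
      then show ?thesis by (simp add: emb0)
    next
      case False
      \<comment> \<open>Scaling \<open>x\<close> to norm \<delta>/2 keeps the strict inequality
        required by \<delta> and accounts for the factor 2 / \<delta>.\<close>
      define t where "t = \<delta> / (2 * nrm x)"
      have pos: "0 < nrm x" by (rule nrm_pos[OF x False])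
      have t: "0 < t" using \<delta>(1) pos by (simp add: t_def)
      define y where "y = of_real t *\<^sub>C x"
      have "nrm y = t * nrm x" using x t by (simp add: y_def)
      also have "\<dots> = \<delta> / 2" using x False by (simp add: t_def)
      finally have "nrm y = \<delta> / 2" .
      then have "norm (emb (0 - (- y))) < 1" using \<delta> x by (intro \<delta>(2)) (auto simp: y_def)
      then have "t * norm (emb x) < 1" using t by (simp add: y_def sc nh)
      then show ?thesis using \<delta>(1) pos by (simp add: t_def field_simps)
    qed
    then show "\<exists>\<alpha>>0. \<forall>x\<in>V. norm (emb x) \<le> \<alpha> * nrm x"
      using \<delta>(1) by (intro exI[of _ "2 / \<delta>"]) auto
  next
    assume "\<exists>\<alpha>>0. \<forall>x\<in>V. norm (emb x) \<le> \<alpha> * nrm x"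
    then obtain \<alpha> where \<alpha>: "\<alpha> > 0" "\<And>x. x \<in> V \<Longrightarrow> norm (emb x) \<le> \<alpha> * nrm x" by blast
    show "continuous_map M.mtopology euclidean emb"
      unfolding iff
    proof (intro ballI allI impI)
      fix a \<epsilon> assume a: "a \<in> V" and \<epsilon>: "\<epsilon> > (0::real)"
      have "norm (emb (a - x)) < \<epsilon>" if "x \<in> V" "nrm (a - x) < \<epsilon> / \<alpha>" for x
        using \<alpha>(2)[of "a - x"] that a \<alpha>(1) by (simp add: field_simps)
      then show "\<exists>\<delta>>0. \<forall>x. x \<in> V \<and> nrm (a - x) < \<delta> \<longrightarrow> norm (emb (a - x)) < \<epsilon>"
        using \<epsilon> \<alpha>(1) by (intro exI[of _ "\<epsilon> / \<alpha>"]) auto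
    qed
  qed
qed

subsection \<open>The Hilbert space of a Krein space\<close>

locale krein_decomposition =
  fixes D :: "'a::complex_vec set" and f :: "'a \<Rightarrow> 'a \<Rightarrow> complex" and Dp Dm :: "'a set"
  assumes subspace_D: "complex_vector.subspace D"
    and sesquilinear: "sesquilinear_on D f" and symmetric: "symmetric_on D f"
    and decomposition: "fundamental_decomposition D f Dp Dm"
begin

abbreviation G :: "'a \<Rightarrow> 'a \<Rightarrow> complex" where "G \<equiv> krein_inner f Dp Dm"

lemma hilbert_plus: "hilbert Dp f" and hilbert_minus: "hilbert Dm (\<lambda>x y. - f x y)"
  and D_eq: "D = {x + y |x y. x \<in> Dp \<and> y \<in> Dm}" and disjoint: "Dp \<inter> Dm = {0}"
  and orthogonal: "x \<in> Dp \<Longrightarrow> y \<in> Dm \<Longrightarrow> f x y = 0"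
  using decomposition by (auto simp: fundamental_decomposition_def hilbert_on_iff)

lemma subspace_plus: "complex_vector.subspace Dp" and subspace_minus: "complex_vector.subspace Dm"
  using hilbert_plus hilbert_minus by (simp_all add: hilbert_def pre_hilbert_def)

text \<open>The same description as that of the projection inside \<open>krein_inner\<close>, so
  that \<open>G\<close> unfolds to an expression in \<open>pr\<close> and \<open>qr\<close>.\<close>

definition pr :: "'a \<Rightarrow> 'a" where "pr x = (THE p. p \<in> Dp \<and> x - p \<in> Dm)"

definition qr :: "'a \<Rightarrow> 'a" where "qr x = x - pr x"

lemma G_def: "G x y = f (pr x) (pr y) - f (qr x) (qr y)"
  by (simp add: krein_inner_def pr_def qr_def)

lemma pr_unique:
  assumes "p \<in> Dp" "m \<in> Dm"
  shows "pr (p + m) = p" "qr (p + m) = m"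
proof -
  show "pr (p + m) = p"
    unfolding pr_def
  proof (rule the_equality)
    show "p \<in> Dp \<and> p + m - p \<in> Dm" using assms by simp
    fix r assume r: "r \<in> Dp \<and> p + m - r \<in> Dm"
    have "r - p \<in> Dp" using r assms subspace_plus complex_vector.subspace_diff by blast
    moreover have "m - (p + m - r) \<in> Dm"
      using r assms subspace_minus complex_vector.subspace_diff by blast
    then have "r - p \<in> Dm" by (simp add: algebra_simps)
    ultimately have "r - p = 0" using disjoint by blast
    then show "r = p" by simp
  qed
  then show "qr (p + m) = m" by (simp add: qr_def)
qed

lemma mem_DI: "p \<in> Dp \<Longrightarrow> m \<in> Dm \<Longrightarrow> p + m \<in> D"
  using D_eq by blast

lemma plus_subset: "Dp \<subseteq> D" and minus_subset: "Dm \<subseteq> D"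
  using mem_DI[of _ 0] mem_DI[of 0] subspace_plus subspace_minus complex_vector.subspace_0 by force+

lemma
  assumes "x \<in> D"
  shows pr_mem: "pr x \<in> Dp" and qr_mem: "qr x \<in> Dm" and pr_plus_qr: "pr x + qr x = x"
proof -
  obtain p m where pm: "x = p + m" "p \<in> Dp" "m \<in> Dm" using assms D_eq by blast
  then show "pr x \<in> Dp" "qr x \<in> Dm" using pr_unique by simp_all
  show "pr x + qr x = x" by (simp add: qr_def)
qed

lemma
  assumes x: "x \<in> D"
  shows pr_add: "y \<in> D \<Longrightarrow> pr (x + y) = pr x + pr y" and qr_add: "y \<in> D \<Longrightarrow> qr (x + y) = qr x + qr y"
    and pr_scale: "pr (a *\<^sub>C x) = a *\<^sub>C pr x" and qr_scale: "qr (a *\<^sub>C x) = a *\<^sub>C qr x"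
proof -
  { assume y: "y \<in> D"
    have *: "x + y = (pr x + pr y) + (qr x + qr y)" by (simp add: qr_def)
    have m: "pr x + pr y \<in> Dp" "qr x + qr y \<in> Dm"
      using pr_mem qr_mem x y subspace_plus subspace_minus complex_vector.subspace_add by blast+
    show "pr (x + y) = pr x + pr y" "qr (x + y) = qr x + qr y"
      using pr_unique[OF m] * by simp_all }
  have *: "a *\<^sub>C x = a *\<^sub>C pr x + a *\<^sub>C qr x"
    by (simp add: pr_plus_qr[OF x] complex_vector.scale_right_distrib[symmetric])
  have m: "a *\<^sub>C pr x \<in> Dp" "a *\<^sub>C qr x \<in> Dm"
    using pr_mem qr_mem x subspace_plus subspace_minus complex_vector.subspace_scale by blast+
  show "pr (a *\<^sub>C x) = a *\<^sub>C pr x" "qr (a *\<^sub>C x) = a *\<^sub>C qr x"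
    using pr_unique[OF m] * by simp_all
qed

lemma
  assumes "x \<in> D" "y \<in> D"
  shows f_add_left: "z \<in> D \<Longrightarrow> f (x + y) z = f x z + f y z"
    and f_add_right: "z \<in> D \<Longrightarrow> f z (x + y) = f z x + f z y"
    and f_scale_left: "f (a *\<^sub>C x) y = a * f x y"
    and f_scale_right: "f x (a *\<^sub>C y) = cnj a * f x y"
  using sesquilinear assms by (auto simp: sesquilinear_on_def)

lemma f_commute: "x \<in> D \<Longrightarrow> y \<in> D \<Longrightarrow> cnj (f x y) = f y x"
  using symmetric unfolding symmetric_on_def by metis

lemma pr_in_D: "x \<in> D \<Longrightarrow> pr x \<in> D" and qr_in_D: "x \<in> D \<Longrightarrow> qr x \<in> D"
  using pr_mem qr_mem plus_subset minus_subset by blast+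

lemma f_split:
  assumes x: "x \<in> D" and y: "y \<in> D"
  shows "f x y = f (pr x) (pr y) + f (qr x) (qr y)"
proof -
  have "f (pr x + qr x) (pr y + qr y) = f (pr x) (pr y) + f (pr x) (qr y) + (f (qr x) (pr y) + f (qr x) (qr y))"
    using x y by (simp add: pr_in_D qr_in_D f_add_left f_add_right complex_vector.subspace_add[OF subspace_D])
  moreover have "f (pr x) (qr y) = 0" using orthogonal pr_mem qr_mem x y by blast
  moreover have "f (qr x) (pr y) = 0"
    using orthogonal[OF pr_mem[OF y] qr_mem[OF x]] f_commute[OF pr_in_D[OF y] qr_in_D[OF x]] by simp
  ultimately show ?thesis using x y by (simp add: pr_plus_qr)
qed

section \<open>The fundamental symmetry and the Hilbert structure of the sum\<close>

definition J :: "'a \<Rightarrow> 'a" where "J x = pr x - qr x"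

lemma
  assumes x: "x \<in> D"
  shows J_mem: "J x \<in> D" and pr_J: "pr (J x) = pr x" and qr_J: "qr (J x) = - qr x"
proof -
  have m: "- qr x \<in> Dm" using qr_mem[OF x] subspace_minus complex_vector.subspace_neg by blast
  have "J x = pr x + - qr x" by (simp add: J_def)
  then show "J x \<in> D" "pr (J x) = pr x" "qr (J x) = - qr x"
    using mem_DI[OF pr_mem[OF x] m] pr_unique[OF pr_mem[OF x] m] by simp_all
qed

lemma J_J: "x \<in> D \<Longrightarrow> J (J x) = x"
  by (simp add: J_def[of "J x"] pr_J qr_J pr_plus_qr)

text \<open>J changes the sign on \<open>Dm\<close>, which is exactly where \<open>f\<close> and
  \<open>G\<close> differ. Combined with \<open>J_J\<close> it turns a vector representing a
  functional by \<open>G\<close> into one representing it by \<open>f\<close>.\<close>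

lemma f_eq_G: "x \<in> D \<Longrightarrow> y \<in> D \<Longrightarrow> f x y = G (J x) y"
  using f_scale_left[of "qr x" "qr y" "-1"]
  by (simp add: G_def f_split pr_J qr_J J_mem qr_in_D)

text \<open>Pythagoras for the orthogonal sum. Definiteness and completeness of \<open>G\<close> are
  both read off from it.\<close>

lemma Re_G:
  assumes x: "x \<in> D"
  shows "Re (G x x) = (form_norm f (pr x))\<^sup>2 + (form_norm (\<lambda>x y. - f x y) (qr x))\<^sup>2"
    and "0 \<le> form_norm f (pr x)" "0 \<le> form_norm (\<lambda>x y. - f x y) (qr x)"
proof -
  interpret P: hilbert Dp f by (rule hilbert_plus)
  interpret M: hilbert Dm "\<lambda>x y. - f x y" by (rule hilbert_minus)
  show "0 \<le> form_norm f (pr x)" by (rule P.nrm_ge_0[OF pr_mem[OF x]])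
  show "0 \<le> form_norm (\<lambda>x y. - f x y) (qr x)" by (rule M.nrm_ge_0[OF qr_mem[OF x]])
  show "Re (G x x) = (form_norm f (pr x))\<^sup>2 + (form_norm (\<lambda>x y. - f x y) (qr x))\<^sup>2"
    using P.self_nonneg[OF pr_mem[OF x]] M.self_nonneg[OF qr_mem[OF x]]
    by (simp add: form_norm_def G_def)
qed

lemma inner_product_G: "inner_product_on D G"
  unfolding inner_product_on_def
proof (intro conjI ballI impI)
  interpret P: hilbert Dp f by (rule hilbert_plus)
  interpret M: hilbert Dm "\<lambda>x y. - f x y" by (rule hilbert_minus)
  show "sesquilinear_on D G"
    unfolding sesquilinear_on_def
    by (simp add: G_def pr_add qr_add pr_scale qr_scale f_add_left f_add_right f_scale_left f_scale_right
        pr_in_D qr_in_D algebra_simps)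
  show "symmetric_on D G"
    unfolding symmetric_on_def by (simp add: G_def f_commute pr_in_D qr_in_D)
  fix x assume x: "x \<in> D" and "x \<noteq> 0"
  then have "pr x \<noteq> 0 \<or> qr x \<noteq> 0" using pr_plus_qr[OF x] by auto
  then have "0 < (form_norm f (pr x))\<^sup>2 + (form_norm (\<lambda>x y. - f x y) (qr x))\<^sup>2"
    using P.nrm_pos[OF pr_mem[OF x]] M.nrm_pos[OF qr_mem[OF x]]
    by (metis add_nonneg_pos add_pos_nonneg zero_le_power2 zero_less_power)
  then show "0 < Re (G x x)" by (simp only: Re_G(1)[OF x])
qed

text \<open>Both projections are contractions, so a Cauchy sequence splits into Cauchy sequences in
  \<open>Dp\<close> and \<open>Dm\<close>. The norm of \<open>G\<close> is at most the sum of the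
  component norms, so the sum of the two limits is the limit.\<close>

lemma hilbert_G: "hilbert D G"
proof -
  interpret pre_hilbert D G using subspace_D inner_product_G by unfold_locales
  let ?n = "form_norm (\<lambda>x y. - f x y)"
  have le: "form_norm f (pr x) \<le> 1 * nrm x" "?n (qr x) \<le> 1 * nrm x" "nrm x \<le> form_norm f (pr x) + ?n (qr x)"
    if x: "x \<in> D" for x
  proof -
    note * = Re_G[OF x] nrm_sq[OF x]
    show "form_norm f (pr x) \<le> 1 * nrm x" "?n (qr x) \<le> 1 * nrm x"
      using * x power2_le_imp_le[of "form_norm f (pr x)" "nrm x"] power2_le_imp_le[of "?n (qr x)" "nrm x"]
      by simp_all
    show "nrm x \<le> form_norm f (pr x) + ?n (qr x)"
      using * power2_le_imp_le[of "nrm x" "form_norm f (pr x) + ?n (qr x)"] by (simp add: power2_sum)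
  qed
  have pd: "pr (x - y) = pr x - pr y" "qr (x - y) = qr x - qr y" if "x \<in> D" "y \<in> D" for x y
    using pr_add[of "x - y" y] qr_add[of "x - y" y] that by simp_all
  show ?thesis
  proof
    fix s assume s: "\<And>k. s k \<in> D" and c: "cauchy_wrt nrm s"
    have "cauchy_wrt (form_norm f) (\<lambda>k. pr (s k))"
      by (rule cauchy_wrt_mono[OF c zero_less_one]) (use le(1)[of "s _ - s _"] s in \<open>simp add: pd\<close>)
    then obtain p where p: "p \<in> Dp" "(\<lambda>k. form_norm f (pr (s k) - p)) \<longlonglongrightarrow> 0"
      using hilbert.complete[OF hilbert_plus, of "\<lambda>k. pr (s k)"] pr_mem s by blast
    have "cauchy_wrt ?n (\<lambda>k. qr (s k))"
      by (rule cauchy_wrt_mono[OF c zero_less_one]) (use le(2)[of "s _ - s _"] s in \<open>simp add: pd\<close>)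
    then obtain m where m: "m \<in> Dm" "(\<lambda>k. ?n (qr (s k) - m)) \<longlonglongrightarrow> 0"
      using hilbert.complete[OF hilbert_minus, of "\<lambda>k. qr (s k)"] qr_mem s by blast
    have a: "p + m \<in> D" using mem_DI p m by blast
    have *: "(\<lambda>k. form_norm f (pr (s k) - p) + ?n (qr (s k) - m)) \<longlonglongrightarrow> 0"
      using tendsto_add[OF p(2) m(2)] by simp
    have "norm (nrm (s k - (p + m))) \<le> form_norm f (pr (s k) - p) + ?n (qr (s k) - m)" for k
      using le(3)[of "s k - (p + m)"] s a pr_unique[OF p(1) m(1)] by (simp add: pd)
    then have "(\<lambda>k. nrm (s k - (p + m))) \<longlonglongrightarrow> 0"
      by (intro Lim_null_comparison[OF _ *] always_eventually) blast
    with a show "\<exists>a\<in>D. (\<lambda>k. nrm (s k - a)) \<longlonglongrightarrow> 0" by blast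
  qed
qed

end

subsection \<open>Solvable forms and Krein spaces\<close>

text \<open>Riesz turns the form into an operator T. Nondegeneracy of \<open>f\<close> becomes
  injectivity of T and \<open>solve\<close> becomes surjectivity; the lower bound on T is
  boundedness of its inverse, which inherits symmetry from T.\<close>

lemma (in hilbert) fundamental_decomposition_of_form:
  assumes f: "sesquilinear_on V f" "symmetric_on V f"
    and b: "0 < b" "\<And>x y. x \<in> V \<Longrightarrow> y \<in> V \<Longrightarrow> cmod (f x y) \<le> b * nrm x * nrm y"
    and nondegenerate: "\<And>x. x \<in> V \<Longrightarrow> \<forall>y\<in>V. f x y = 0 \<Longrightarrow> x = 0"
    and solve: "\<And>\<Lambda>. \<Lambda> \<in> conj_dual_space V nrm \<Longrightarrow> \<exists>x\<in>V. \<forall>y\<in>V. \<Lambda> y = f x y"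
  obtains Dp Dm d where "fundamental_decomposition V f Dp Dm" "0 < d" "Dp \<subseteq> V" "Dm \<subseteq> V"
    "\<And>x. x \<in> Dp \<Longrightarrow> d * (nrm x)\<^sup>2 \<le> Re (f x x)" "\<And>x. x \<in> Dm \<Longrightarrow> d * (nrm x)\<^sup>2 \<le> - Re (f x x)"
proof -
  have f_add: "f (x + y) z = f x z + f y z" "f z (x + y) = f z x + f z y"
    if "x \<in> V" "y \<in> V" "z \<in> V" for x y z
    using f(1) that by (auto simp: sesquilinear_on_def)
  have f_sc: "f (a *\<^sub>C x) y = a * f x y" "f x (a *\<^sub>C y) = cnj a * f x y" if "x \<in> V" "y \<in> V" for x y a
    using f(1) that by (auto simp: sesquilinear_on_def)
  have f_comm: "cnj (f x y) = f y x" if "x \<in> V" "y \<in> V" for x y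
    using f(2) that unfolding symmetric_on_def by metis
  have "\<exists>z\<in>V. \<forall>y\<in>V. f x y = of_real b * g z y" if x: "x \<in> V" for x
  proof -
    obtain z where "z \<in> V" "\<And>y. y \<in> V \<Longrightarrow> f x y / of_real b = g z y"
    proof (rule Riesz_representation_conj[of "\<lambda>y. f x y / of_real b" "nrm x"])
      show "f x (y + z) / of_real b = f x y / of_real b + f x z / of_real b" if "y \<in> V" "z \<in> V" for y z
        using x that by (simp add: f_add add_divide_distrib)
      show "f x (a *\<^sub>C y) / of_real b = cnj a * (f x y / of_real b)" if "y \<in> V" for a y
        using x that by (simp add: f_sc)
      show "cmod (f x y / of_real b) \<le> nrm x * nrm y" if "y \<in> V" for y
        using b(2)[OF x that] b(1) by (simp add: norm_divide field_simps)
    qed blast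
    then show ?thesis using b(1) by (intro bexI[of _ z]) (auto simp: field_simps)
  qed
  then obtain T where Tm: "\<And>x. x \<in> V \<Longrightarrow> T x \<in> V"
    and fT: "\<And>x y. x \<in> V \<Longrightarrow> y \<in> V \<Longrightarrow> f x y = of_real b * g (T x) y" by metis
  have gT: "g (T x) y = f x y / of_real b" if "x \<in> V" "y \<in> V" for x y
    using fT that b(1) by simp
  have T: "linear_op T"
  proof (rule linear_opI)
    show "T x \<in> V" if "x \<in> V" for x by (rule Tm[OF that])
    show "T (x + y) = T x + T y" if "x \<in> V" "y \<in> V" for x y
      by (rule eqI) (use that Tm in \<open>auto simp: gT f_add add_divide_distrib\<close>)
    show "T (a *\<^sub>C x) = a *\<^sub>C T x" if "x \<in> V" for a x
      by (rule eqI) (use that Tm in \<open>auto simp: gT f_sc\<close>)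
  qed
  have symT: "symmetric_op T"
    unfolding symmetric_op_def
  proof (intro ballI)
    fix x y assume xy: "x \<in> V" "y \<in> V"
    have "g x (T y) = cnj (g (T y) x)" using xy Tm by (simp add: commute)
    also have "\<dots> = g (T x) y" using xy by (simp add: gT f_comm)
    finally show "g (T x) y = g x (T y)" by simp
  qed
  have bdT: "bounded_op 1 T"
    unfolding bounded_op_def
  proof
    fix x assume x: "x \<in> V"
    \<comment> \<open>The form is tested at \<open>y = T x\<close>, and one factor
      \<open>nrm (T x)\<close> is cancelled at the end.\<close>
    have "of_real ((nrm (T x))\<^sup>2) = f x (T x) / of_real b"
      using x Tm by (simp add: gT[symmetric] self_eq)
    then have "cmod (of_real ((nrm (T x))\<^sup>2)) = cmod (f x (T x) / of_real b)" by (rule arg_cong)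
    then have "(nrm (T x))\<^sup>2 = cmod (f x (T x)) / b" using b(1) by (simp add: norm_divide norm_power)
    also have "\<dots> \<le> nrm x * nrm (T x)" using b(2)[OF x Tm[OF x]] b(1) by (simp add: field_simps)
    finally have "nrm (T x) * nrm (T x) \<le> nrm x * nrm (T x)" by (simp add: power2_eq_square)
    then show "nrm (T x) \<le> 1 * nrm x"
      using Tm[OF x] x nrm_ge_0[OF Tm[OF x]] by (cases "nrm (T x) = 0") (auto simp: mult_le_cancel_right)
  qed
  have surj: "\<exists>x\<in>V. T x = z" if z: "z \<in> V" for z
  proof -
    \<comment> \<open>A preimage of \<open>z\<close> under T is a solution for the functional b g(z,
      \<sqdot>), extended by 0 as \<open>conj_dual_space\<close> prescribes.\<close>
    have "(\<lambda>y. if y \<in> V then of_real b * g z y else 0) \<in> conj_dual_space V nrm"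
      unfolding conj_dual_space_def
    proof (intro CollectI conjI ballI allI impI exI[of _ "b * nrm z"])
      show "cmod (if y \<in> V then of_real b * g z y else 0) \<le> b * nrm z * nrm y" if "y \<in> V" for y
        using that Cauchy_Schwarz[OF z that] b(1) by (simp add: norm_mult mult.assoc)
    qed (use z in \<open>auto simp: algebra_simps\<close>)
    then obtain x where x: "x \<in> V" "\<And>y. y \<in> V \<Longrightarrow> of_real b * g z y = f x y"
      using solve by force
    have "T x = z" by (rule eqI) (use x z Tm b(1) in \<open>auto simp: gT x(2)[symmetric]\<close>)
    then show ?thesis using x(1) by blast
  qed
  then obtain S where Sm: "\<And>z. z \<in> V \<Longrightarrow> S z \<in> V" and TS: "\<And>z. z \<in> V \<Longrightarrow> T (S z) = z" by metis
  have inj: "x = y" if "x \<in> V" "y \<in> V" "T x = T y" for x y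
  proof -
    have "T (x - y) = 0" using op_diff[OF T] that by simp
    then have "\<forall>z\<in>V. f (x - y) z = 0" using that by (simp add: fT)
    then show ?thesis using nondegenerate[of "x - y"] that by simp
  qed
  have S: "linear_op S"
  proof (rule linear_opI)
    show "S x \<in> V" if "x \<in> V" for x by (rule Sm[OF that])
    show "S (x + y) = S x + S y" if "x \<in> V" "y \<in> V" for x y
      by (rule inj) (use that Sm in \<open>auto simp: op_add[OF T] TS\<close>)
    show "S (a *\<^sub>C x) = a *\<^sub>C S x" if "x \<in> V" for a x
      by (rule inj) (use that Sm in \<open>auto simp: op_scale[OF T] TS\<close>)
  qed
  have symS: "symmetric_op S"
    unfolding symmetric_op_def
  proof (intro ballI)
    fix x y assume xy: "x \<in> V" "y \<in> V"
    have "g (S x) (T (S y)) = g (T (S x)) (S y)"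
      using symT Sm xy by (simp add: symmetric_op_def)
    then show "g (S x) y = g x (S y)" using xy by (simp add: TS)
  qed
  obtain K where K: "bounded_op K S" by (rule Hellinger_Toeplitz[OF S symS])
  \<comment> \<open>\<open>bounded_op K S\<close> puts no sign on \<open>K\<close>; the maximum with
    1 makes \<open>c\<close> positive and at most 1, as the modulus requires.\<close>
  define c where "c = 1 / max 1 K"
  have c: "0 < c" "c \<le> 1" by (simp_all add: c_def)
  have lower: "c * nrm x \<le> nrm (T x)" if x: "x \<in> V" for x
  proof -
    have "S (T x) = x" by (rule inj) (use x Sm Tm TS in auto)
    then have "nrm x \<le> K * nrm (T x)" using K Tm[OF x] unfolding bounded_op_def by metis
    also have "\<dots> \<le> max 1 K * nrm (T x)" using Tm[OF x] by (intro mult_right_mono) auto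
    finally show ?thesis by (simp add: c_def field_simps)
  qed
  show thesis
    by (rule fundamental_decomposition_of_operator[OF T symT bdT surj c lower f b(1) fT that])
qed

theorem corollary7p6:
  fixes D :: "'h::complex_hilbert set"
    and \<Omega> :: "'h \<Rightarrow> 'h \<Rightarrow> complex"
    and l :: real
  assumes "complex_vector.subspace D"
    and "closure D = UNIV"
    and "sesquilinear_on D \<Omega>"
    and "symmetric_on D \<Omega>"
  shows "closed_with_gap_point D \<Omega> l \<longleftrightarrow>
    (\<exists>g. inner_product_on D g \<and> solvable D \<Omega> (form_norm g) \<and>
         (\<lambda>x y. - (complex_of_real l * cinner x y)) \<in> \<PP> D \<Omega> (form_norm g))"
proof -
  define f where "f x y = \<Omega> x y - of_real l * cinner x y" for x y
  define \<Upsilon> :: "'h \<Rightarrow> 'h \<Rightarrow> complex" where "\<Upsilon> = (\<lambda>x y. - (of_real l * cinner x y))"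
  have f_\<Upsilon>: "\<Omega> x y + \<Upsilon> x y = f x y" for x y by (simp add: f_def \<Upsilon>_def)
  have \<Upsilon>_sesq: "sesquilinear_on V \<Upsilon>" for V
    using sesquilinear_on_cinner[of V] unfolding sesquilinear_on_def \<Upsilon>_def by (simp add: algebra_simps)
  \<comment> \<open>Here it matters that \<open>l\<close> is real: \<Upsilon> is symmetric, and so
    is the shifted form \<open>f\<close>.\<close>
  have \<Upsilon>_sym: "cnj (\<Upsilon> x y) = \<Upsilon> y x" for x y by (simp add: \<Upsilon>_def cinner_commute[of x y])
  have \<Upsilon>_bound: "cmod (\<Upsilon> x y) \<le> \<bar>l\<bar> * norm x * norm y" for x y
    using norm_cinner_le[of x y] by (simp add: \<Upsilon>_def norm_mult mult.assoc mult_left_mono)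
  have \<Upsilon>: "bounded_form \<Upsilon>" unfolding bounded_form_def using \<Upsilon>_sesq \<Upsilon>_bound by blast
  have f_sesq: "sesquilinear_on D f"
    using assms(3) \<Upsilon>_sesq[of D] unfolding sesquilinear_on_def f_\<Upsilon>[symmetric]
    by (simp add: algebra_simps)
  have f_sym: "symmetric_on D f"
    using assms(4) \<Upsilon>_sym unfolding symmetric_on_def f_\<Upsilon>[symmetric] by (metis complex_cnj_add)
  have mem_\<PP>_iff: "\<Upsilon> \<in> \<PP> D \<Omega> n \<longleftrightarrow> (\<forall>x\<in>D. (\<forall>y\<in>D. f x y = 0) \<longrightarrow> x = 0) \<and>
     (\<forall>\<Lambda>\<in>conj_dual_space D n. \<exists>x\<in>D. \<forall>y\<in>D. \<Lambda> y = f x y)" for n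
    using \<Upsilon> by (simp add: solving_perturbations_def f_\<Upsilon>)
  \<comment> \<open>Membership of \<Upsilon> already shows that \<open>\<PP>\<close> is nonempty, so
    \<open>solvable\<close> reduces to \<open>q_closed\<close>.\<close>
  have "closed_with_gap_point D \<Omega> l \<longleftrightarrow>
    (\<exists>g. inner_product_on D g \<and> q_closed D \<Omega> (form_norm g) \<and> \<Upsilon> \<in> \<PP> D \<Omega> (form_norm g))"
    (is "?L \<longleftrightarrow> ?R")
  proof
    assume ?L
    then obtain Dp Dm where dec: "fundamental_decomposition D f Dp Dm"
      and cont: "continuous_map (krein_topology D f Dp Dm) euclidean (\<lambda>x. x)"
      unfolding closed_with_gap_point_def continuously_embedded_krein_space_def f_def[symmetric] by blast
    interpret K: krein_decomposition D f Dp Dm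
      using assms(1) f_sesq f_sym dec by unfold_locales
    interpret hilbert D K.G by (rule K.hilbert_G)
    obtain \<alpha> where \<alpha>: "\<alpha> > 0" "\<And>x. x \<in> D \<Longrightarrow> norm x \<le> \<alpha> * nrm x"
      using cont continuous_map_embedding_iff[of "\<lambda>x. x"] unfolding krein_topology_def by auto
    have J_nrm: "nrm (K.J x) = nrm x" if x: "x \<in> D" for x
    proof -
      have "K.G (K.J x) (K.J x) = K.G x x"
        using K.f_scale_left[of "K.qr x" "K.qr x" "-1"] K.f_scale_left[of "K.qr x" "- K.qr x" "-1"]
          K.f_scale_right[of "K.qr x" "K.qr x" "-1"] x
        by (simp add: K.G_def K.pr_J K.qr_J K.qr_in_D)
      then show ?thesis by (simp add: form_norm_def)
    qed
    have f_bound: "cmod (f x y) \<le> nrm x * nrm y" if "x \<in> D" "y \<in> D" for x y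
      using Cauchy_Schwarz[of "K.J x" y] that by (simp add: K.f_eq_G K.J_mem J_nrm)
    \<comment> \<open>\<Omega> is \<open>f\<close> minus \<Upsilon>. The form \<open>f\<close> has
      bound 1 because J is isometric; \<Upsilon> is bounded by |l| in the norm of H, and each of its
      two arguments costs a factor \<alpha> from the embedding.\<close>
    have \<Omega>_bound: "cmod (\<Omega> x y) \<le> (1 + \<bar>l\<bar> * \<alpha>\<^sup>2) * nrm x * nrm y" if xy: "x \<in> D" "y \<in> D" for x y
    proof -
      have "cmod (\<Omega> x y) = cmod (f x y - \<Upsilon> x y)" by (simp add: f_\<Upsilon>[symmetric])
      also have "\<dots> \<le> cmod (f x y) + cmod (\<Upsilon> x y)" by (rule norm_triangle_ineq4)
      also have "\<dots> \<le> nrm x * nrm y + \<bar>l\<bar> * norm x * norm y"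
        using f_bound[OF xy] \<Upsilon>_bound by (rule add_mono)
      also have "\<bar>l\<bar> * norm x * norm y \<le> \<bar>l\<bar> * (\<alpha> * nrm x) * (\<alpha> * nrm y)"
        using \<alpha> xy by (intro mult_mono) auto
      finally show ?thesis by (simp add: algebra_simps power2_eq_square)
    qed
    \<comment> \<open>Condition (2): completeness gives a limit \<open>a\<close> in D. By the
      embedding \<open>a\<close> is also the limit in H, which is 0.\<close>
    have "(\<lambda>k. nrm (s k)) \<longlonglongrightarrow> 0"
      if c: "Metric_space.MCauchy D (norm_dist D nrm) s" and s0: "(\<lambda>k. norm (s k)) \<longlonglongrightarrow> 0" for s
    proof -
      interpret M: Metric_space D "norm_dist D nrm" by (rule Metric_space_norm_dist[OF subspace norm_on])
      have s: "s k \<in> D" for k using c by (auto simp: M.MCauchy_def)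
      have "cauchy_wrt nrm s"
        using c s by (simp add: M.MCauchy_def cauchy_wrt_def norm_dist_def)
      then obtain a where a: "a \<in> D" and lim: "(\<lambda>k. nrm (s k - a)) \<longlonglongrightarrow> 0" using complete s by blast
      have *: "(\<lambda>k. norm (s k) + \<alpha> * nrm (s k - a)) \<longlonglongrightarrow> 0"
        using tendsto_add[OF s0 tendsto_mult_right_zero[OF lim]] by simp
      have "norm a \<le> norm (s k) + \<alpha> * nrm (s k - a)" for k
        using norm_triangle_ineq4[of "s k" "s k - a"] \<alpha>(2)[of "s k - a"] s a by simp
      then have "norm a \<le> 0" by (intro LIMSEQ_le_const[OF *]) auto
      then show ?thesis using lim by simp
    qed
    moreover have "\<exists>\<beta>>0. \<forall>x\<in>D. \<forall>y\<in>D. cmod (\<Omega> x y) \<le> \<beta> * nrm x * nrm y"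
      using \<Omega>_bound by (intro exI[of _ "1 + \<bar>l\<bar> * \<alpha>\<^sup>2"]) (auto simp: add_pos_nonneg)
    ultimately have q: "q_closed D \<Omega> nrm"
      unfolding q_closed_def using assms norm_on reflexive \<alpha> by blast
    have "\<Upsilon> \<in> \<PP> D \<Omega> nrm"
      unfolding mem_\<PP>_iff
    proof (intro conjI ballI impI)
      fix x assume x: "x \<in> D" and "\<forall>y\<in>D. f x y = 0"
      \<comment> \<open>Taking \<open>y = K.J x\<close> in the hypothesis turns \<open>f x y\<close>
        into the squared norm of \<open>K.J x\<close>.\<close>
      then have "K.G (K.J x) (K.J x) = 0" using K.J_mem[OF x] K.f_eq_G[OF x] by metis
      then show "x = 0" using J_nrm[OF x] x by (metis form_norm_def nrm_eq_0_iff real_sqrt_zero zero_complex.sel(1))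
    next
      fix \<Lambda> assume \<Lambda>: "\<Lambda> \<in> conj_dual_space D nrm"
      then obtain C where C: "\<forall>y\<in>D. cmod (\<Lambda> y) \<le> C * nrm y"
        and lin: "\<forall>x\<in>D. \<forall>y\<in>D. \<Lambda> (x + y) = \<Lambda> x + \<Lambda> y" "\<forall>a. \<forall>x\<in>D. \<Lambda> (a *\<^sub>C x) = cnj a * \<Lambda> x"
        unfolding conj_dual_space_def by blast
      obtain z where z: "z \<in> D" "\<And>y. y \<in> D \<Longrightarrow> \<Lambda> y = K.G z y"
        by (rule Riesz_representation_conj[of \<Lambda> C]) (use C lin in blast)+
      then have "\<forall>y\<in>D. \<Lambda> y = f (K.J z) y" by (simp add: K.f_eq_G K.J_mem K.J_J)
      then show "\<exists>x\<in>D. \<forall>y\<in>D. \<Lambda> y = f x y" using K.J_mem[OF z(1)] by blast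
    qed
    with q show ?R using inner_product by blast
  next
    assume ?R
    then obtain g where ip: "inner_product_on D g" and q: "q_closed D \<Omega> (form_norm g)"
      and P: "\<Upsilon> \<in> \<PP> D \<Omega> (form_norm g)" by blast
    have "hilbert_on D g"
      using ip q by (simp add: hilbert_on_def q_closed_def reflexive_banach_on_def)
    then interpret hilbert D g by (simp add: hilbert_on_iff)
    obtain \<alpha> where \<alpha>: "\<alpha> > 0" "\<And>x. x \<in> D \<Longrightarrow> norm x \<le> \<alpha> * nrm x"
      using q by (auto simp: q_closed_def)
    obtain \<beta> where \<beta>: "\<beta> > 0" "\<And>x y. x \<in> D \<Longrightarrow> y \<in> D \<Longrightarrow> cmod (\<Omega> x y) \<le> \<beta> * nrm x * nrm y"
      using q by (auto simp: q_closed_def)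
    have b: "0 < \<beta> + \<bar>l\<bar> * \<alpha>\<^sup>2" using \<beta>(1) by (simp add: add_pos_nonneg)
    have f_bound: "cmod (f x y) \<le> (\<beta> + \<bar>l\<bar> * \<alpha>\<^sup>2) * nrm x * nrm y" if xy: "x \<in> D" "y \<in> D" for x y
    proof -
      have "cmod (f x y) \<le> cmod (\<Omega> x y) + cmod (\<Upsilon> x y)"
        unfolding f_\<Upsilon>[symmetric] by (rule norm_triangle_ineq)
      also have "\<dots> \<le> \<beta> * nrm x * nrm y + \<bar>l\<bar> * norm x * norm y"
        using \<beta>(2)[OF xy] \<Upsilon>_bound by (rule add_mono)
      also have "\<bar>l\<bar> * norm x * norm y \<le> \<bar>l\<bar> * (\<alpha> * nrm x) * (\<alpha> * nrm y)"
        using \<alpha> xy by (intro mult_mono) auto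
      finally show ?thesis by (simp add: algebra_simps power2_eq_square)
    qed
    have nondegenerate: "x = 0" if "x \<in> D" "\<forall>y\<in>D. f x y = 0" for x
      using P that unfolding mem_\<PP>_iff by blast
    have solve: "\<exists>x\<in>D. \<forall>y\<in>D. \<Lambda> y = f x y" if "\<Lambda> \<in> conj_dual_space D nrm" for \<Lambda>
      using P that unfolding mem_\<PP>_iff by blast
    obtain Dp Dm d where dec: "fundamental_decomposition D f Dp Dm" and d: "0 < d"
      and sub: "Dp \<subseteq> D" "Dm \<subseteq> D"
      and lo: "\<And>x. x \<in> Dp \<Longrightarrow> d * (nrm x)\<^sup>2 \<le> Re (f x x)" "\<And>x. x \<in> Dm \<Longrightarrow> d * (nrm x)\<^sup>2 \<le> - Re (f x x)"
      by (rule fundamental_decomposition_of_form[OF f_sesq f_sym b f_bound nondegenerate solve]) blast+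
    interpret K: krein_decomposition D f Dp Dm
      using assms(1) f_sesq f_sym dec by unfold_locales
    interpret KG: hilbert D K.G by (rule K.hilbert_G)
    \<comment> \<open>The factor 2 comes from (p + q)^2 \<le> 2 (p^2 + q^2) for the norms of the two
      components, and 1 / d from the uniform positivity of the form, up to sign, on each summand.
      The embedding known for \<open>g\<close> then also holds for the Krein norm.\<close>
    have nrm_le: "nrm x \<le> sqrt (2 / d) * KG.nrm x" if x: "x \<in> D" for x
    proof -
      have pq: "K.pr x \<in> D" "K.qr x \<in> D" using K.pr_in_D K.qr_in_D x by blast+
      have "(nrm x)\<^sup>2 \<le> (nrm (K.pr x) + nrm (K.qr x))\<^sup>2"
        using nrm_triangle[OF pq] x by (intro power_mono) (auto simp: K.pr_plus_qr)
      also have "\<dots> \<le> 2 * ((nrm (K.pr x))\<^sup>2 + (nrm (K.qr x))\<^sup>2)"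
        using sum_squares_bound[of "nrm (K.pr x)" "nrm (K.qr x)"] by (simp add: power2_sum)
      also have "\<dots> \<le> 2 / d * Re (K.G x x)"
        using lo(1)[OF K.pr_mem[OF x]] lo(2)[OF K.qr_mem[OF x]] d
        by (simp add: K.G_def field_simps)
      also have "\<dots> = 2 / d * (KG.nrm x)\<^sup>2" by (simp only: KG.nrm_sq[OF x])
      also have "\<dots> = (sqrt (2 / d) * KG.nrm x)\<^sup>2" using d by (simp add: power_mult_distrib)
      finally show ?thesis
        using d x by (intro power2_le_imp_le[of "nrm x"]) auto
    qed
    have "norm x \<le> (\<alpha> * sqrt (2 / d)) * KG.nrm x" if x: "x \<in> D" for x
    proof -
      have "norm x \<le> \<alpha> * nrm x" by (rule \<alpha>(2)[OF x])
      also have "\<dots> \<le> \<alpha> * (sqrt (2 / d) * KG.nrm x)"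
        using nrm_le[OF x] \<alpha>(1) by (intro mult_left_mono) auto
      finally show ?thesis by (simp only: mult.assoc)
    qed
    moreover have "0 < \<alpha> * sqrt (2 / d)" using \<alpha>(1) d by simp
    ultimately have "continuous_map (krein_topology D f Dp Dm) euclidean (\<lambda>x. x)"
      unfolding krein_topology_def using KG.continuous_map_embedding_iff[of "\<lambda>x. x"] by auto
    then show ?L
      unfolding closed_with_gap_point_def continuously_embedded_krein_space_def krein_space_def
        f_def[symmetric]
      using dec assms(1) f_sesq f_sym by blast
  qed
  then show ?thesis unfolding solvable_def \<Upsilon>_def by blast
qed

end
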